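(* There is an algorithm which, given a trie $T$ of size $r$ and a pattern $P$ of length $m$, computes, in $O(r\log m)$ total time, the value $$C_T(v)=\sum_{j=1}^{m}\mathrm{str}_T(v,m)[j]\cdot P[j]$$ for all nodes $v$ of $T$ whose depth is at least $m$.
   Context: Strings are over an integer alphabet $\Sigma$ (characters are treated as numerical values), and $P\in\Sigma^{+}$ is an (uncompressed) string with $m=|P|$; $w[j]$ denotes the $j$-th character of a string $w$ (1-indexed). A trie $T$ is a rooted tree whose edges are labeled with characters of $\Sigma$, the edges from a node to its children having pairwise distinct labels; its size $r$ is its number of nodes. The depth $\mathrm{depth}(v)$ of a node $v$ is the number of edges on the path from the root to $v$. For a node $v$ of $T$ and a positive integer $k$, $\mathrm{str}_T(v,k)$ denotes the suffix of length $\min\{k,\mathrm{depth}(v)\}$ of the string spelled out by the edge labels on the path from the root of $T$ to $v$. Model of computation: the word RAM, with constant-time operations on values representing lengths and positions, and constant-time arithmetic operations on the numerical values being convolved; in particular, the convolution $C[i]=\sum_{j=1}^{m'}V_P[j]\cdot V_S[i+j-1]$ ($1\le i\le N'-m'+1$) between a vector $V_S$ of length $N'$ and a vector $V_P$ of length $m'\le N'$ can be computed in $O(N'\log m')$ time by FFT. In the bounds, $\log x$ is read as $\max\{1,\log x\}$. *)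

theory Defs
  imports Complex_Main
begin

section \<open>Tries\<close>

text \<open>
  The nodes of a trie with \<open>r\<close> nodes are numbered \<open>0, \<dots>, r - 1\<close>, in no particular order.
  The label of the edge from \<open>parent T v\<close> to \<open>v\<close> is stored at its lower end \<open>v\<close>; the values of
  \<open>parent\<close> and \<open>edge_label\<close> at the root, and outside the node set, carry no meaning.
\<close>

record trie =
  trie_size :: nat
  trie_root :: nat
  parent :: "nat \<Rightarrow> nat"
  edge_label :: "nat \<Rightarrow> int"

definition is_trie :: "trie \<Rightarrow> bool" where
  "is_trie T \<longleftrightarrow>
     trie_root T < trie_size T \<and>
     (\<forall>v < trie_size T. v \<noteq> trie_root T \<longrightarrow> parent T v < trie_size T) \<and>
     (\<forall>v < trie_size T. \<exists>d. (parent T ^^ d) v = trie_root T) \<and>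
     (\<forall>u < trie_size T. \<forall>v < trie_size T. u \<noteq> trie_root T \<longrightarrow> v \<noteq> trie_root T \<longrightarrow> u \<noteq> v \<longrightarrow>
        parent T u = parent T v \<longrightarrow> edge_label T u \<noteq> edge_label T v)"

definition depth :: "trie \<Rightarrow> nat \<Rightarrow> nat" where
  "depth T v = (LEAST d. (parent T ^^ d) v = trie_root T)"

definition root_str :: "trie \<Rightarrow> nat \<Rightarrow> int list" where
  "root_str T v = rev (map (\<lambda>i. edge_label T ((parent T ^^ i) v)) [0..<depth T v])"

definition str :: "trie \<Rightarrow> nat \<Rightarrow> nat \<Rightarrow> int list" where
  "str T v k = drop (depth T v - k) (root_str T v)"

lemma length_str: "length (str T v k) = min k (depth T v)"
  by (simp add: str_def root_str_def)

definition trie_conv :: "trie \<Rightarrow> int list \<Rightarrow> nat \<Rightarrow> int" where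
  "trie_conv T P v = (\<Sum>j = 1..length P. str T v (length P) ! (j - 1) * P ! (j - 1))"


section \<open>The word RAM\<close>

text \<open>
  A structured language for the word RAM with words of \<open>w\<close> bits. Storage is two-sorted: words
  (lengths, positions, node numbers) live in registers and word arrays; the numerical values that
  are convolved live in value arrays. A program mentions finitely many registers and arrays, so
  the arrays can be interleaved in a single memory at constant overhead.

  On values only ring operations are available, and there is no passage from values to words:
  unit-cost arithmetic on unbounded integers therefore cannot be used to do packed computations
  whose results are read back.
\<close>

datatype wop = Add | Sub | Mul | Div | Mod

datatype wexp =
    WConst nat
  | Reg string
  | WGet string wexp
  | WOp wop wexp wexp

datatype vop = VAdd | VSub | VMul

datatype vexp =
    VConst int
  | VGet string wexp
  | VOp vop vexp vexp

datatype bexp =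
    Less wexp wexp
  | Eq wexp wexp
  | Not bexp
  | And bexp bexp

text \<open>
  \<open>Convolve D S n Q k\<close> convolves the vector in the first \<open>n\<close> cells of \<open>S\<close> with the vector in the
  first \<open>k\<close> cells of \<open>Q\<close> and writes the result to the first \<open>n - k + 1\<close> cells of \<open>D\<close>.
\<close>

datatype com =
    Skip
  | Assign string wexp
  | WSet string wexp wexp
  | VSet string wexp vexp
  | Convolve string string wexp string wexp
  | Seq com com
  | If bexp com com
  | While bexp com

record state =
  reg :: "string \<Rightarrow> nat"
  warr :: "string \<Rightarrow> nat \<Rightarrow> nat"
  varr :: "string \<Rightarrow> nat \<Rightarrow> int"

text \<open>Addition and multiplication of words wrap around; subtraction is truncated at \<open>0\<close>.\<close>

fun wop_val :: "nat \<Rightarrow> wop \<Rightarrow> nat \<Rightarrow> nat \<Rightarrow> nat" where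
  "wop_val w Add a b = (a + b) mod 2 ^ w"
| "wop_val w Sub a b = a - b"
| "wop_val w Mul a b = (a * b) mod 2 ^ w"
| "wop_val w Div a b = a div b"
| "wop_val w Mod a b = a mod b"

fun wval :: "nat \<Rightarrow> wexp \<Rightarrow> state \<Rightarrow> nat" where
  "wval w (WConst n) s = n mod 2 ^ w"
| "wval w (Reg x) s = reg s x"
| "wval w (WGet A e) s = warr s A (wval w e s)"
| "wval w (WOp f e1 e2) s = wop_val w f (wval w e1 s) (wval w e2 s)"

fun vop_val :: "vop \<Rightarrow> int \<Rightarrow> int \<Rightarrow> int" where
  "vop_val VAdd a b = a + b"
| "vop_val VSub a b = a - b"
| "vop_val VMul a b = a * b"

fun vval :: "nat \<Rightarrow> vexp \<Rightarrow> state \<Rightarrow> int" where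
  "vval w (VConst z) s = z"
| "vval w (VGet A e) s = varr s A (wval w e s)"
| "vval w (VOp f e1 e2) s = vop_val f (vval w e1 s) (vval w e2 s)"

fun bval :: "nat \<Rightarrow> bexp \<Rightarrow> state \<Rightarrow> bool" where
  "bval w (Less e1 e2) s \<longleftrightarrow> wval w e1 s < wval w e2 s"
| "bval w (Eq e1 e2) s \<longleftrightarrow> wval w e1 s = wval w e2 s"
| "bval w (Not b) s \<longleftrightarrow> \<not> bval w b s"
| "bval w (And b1 b2) s \<longleftrightarrow> bval w b1 s \<and> bval w b2 s"

text \<open>Every constant, access and operation in an expression is charged one step.\<close>

fun wcost :: "wexp \<Rightarrow> nat" where
  "wcost (WConst n) = 1"
| "wcost (Reg x) = 1"
| "wcost (WGet A e) = 1 + wcost e"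
| "wcost (WOp f e1 e2) = 1 + wcost e1 + wcost e2"

fun vcost :: "vexp \<Rightarrow> nat" where
  "vcost (VConst z) = 1"
| "vcost (VGet A e) = 1 + wcost e"
| "vcost (VOp f e1 e2) = 1 + vcost e1 + vcost e2"

fun bcost :: "bexp \<Rightarrow> nat" where
  "bcost (Less e1 e2) = 1 + wcost e1 + wcost e2"
| "bcost (Eq e1 e2) = 1 + wcost e1 + wcost e2"
| "bcost (Not b) = 1 + bcost b"
| "bcost (And b1 b2) = 1 + bcost b1 + bcost b2"

definition conv :: "(nat \<Rightarrow> int) \<Rightarrow> (nat \<Rightarrow> int) \<Rightarrow> nat \<Rightarrow> nat \<Rightarrow> int" where
  "conv VS VP k i = (\<Sum>j<k. VP j * VS (i + j))"

text \<open>
  \<open>exec tc w c s t s'\<close>: started in \<open>s\<close>, the program \<open>c\<close> halts in \<open>s'\<close> after exactly \<open>t\<close> steps.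
  A convolution of vectors of lengths \<open>n\<close> and \<open>k\<close> takes \<open>tc n k\<close> steps; it has no
  transition unless \<open>0 < k \<le> n\<close>.
\<close>

inductive exec :: "(nat \<Rightarrow> nat \<Rightarrow> nat) \<Rightarrow> nat \<Rightarrow> com \<Rightarrow> state \<Rightarrow> nat \<Rightarrow> state \<Rightarrow> bool"
  for tc :: "nat \<Rightarrow> nat \<Rightarrow> nat" and w :: nat
where
  Skip: "exec tc w Skip s 1 s"
| Assign: "exec tc w (Assign x e) s (1 + wcost e)
    (s\<lparr>reg := (reg s)(x := wval w e s)\<rparr>)"
| WSet: "exec tc w (WSet A i e) s (1 + wcost i + wcost e)
    (s\<lparr>warr := (warr s)(A := (warr s A)(wval w i s := wval w e s))\<rparr>)"
| VSet: "exec tc w (VSet A i e) s (1 + wcost i + vcost e)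
    (s\<lparr>varr := (varr s)(A := (varr s A)(wval w i s := vval w e s))\<rparr>)"
| Convolve: "\<lbrakk>n = wval w ne s; k = wval w ke s; 0 < k; k \<le> n\<rbrakk> \<Longrightarrow>
    exec tc w (Convolve D S ne Q ke) s (1 + wcost ne + wcost ke + tc n k)
      (s\<lparr>varr := (varr s)(D := (\<lambda>i. if i \<le> n - k then conv (varr s S) (varr s Q) k i
                                   else varr s D i))\<rparr>)"
| Seq: "\<lbrakk>exec tc w c1 s t1 s1; exec tc w c2 s1 t2 s2\<rbrakk> \<Longrightarrow>
    exec tc w (Seq c1 c2) s (t1 + t2) s2"
| IfTrue: "\<lbrakk>bval w b s; exec tc w c1 s t s1\<rbrakk> \<Longrightarrow>
    exec tc w (If b c1 c2) s (1 + bcost b + t) s1"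
| IfFalse: "\<lbrakk>\<not> bval w b s; exec tc w c2 s t s1\<rbrakk> \<Longrightarrow>
    exec tc w (If b c1 c2) s (1 + bcost b + t) s1"
| WhileFalse: "\<not> bval w b s \<Longrightarrow> exec tc w (While b c) s (1 + bcost b) s"
| WhileTrue: "\<lbrakk>bval w b s; exec tc w c s t1 s1; exec tc w (While b c) s1 t2 s2\<rbrakk> \<Longrightarrow>
    exec tc w (While b c) s (1 + bcost b + t1 + t2) s2"

inductive_cases SkipE: "exec tc w Skip s t s'"
inductive_cases AssignE: "exec tc w (Assign x e) s t s'"
inductive_cases WSetE: "exec tc w (WSet A i e) s t s'"
inductive_cases VSetE: "exec tc w (VSet A i e) s t s'"
inductive_cases ConvolveE: "exec tc w (Convolve D S ne Q ke) s t s'"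
inductive_cases SeqE: "exec tc w (Seq c1 c2) s t s'"
inductive_cases IfE: "exec tc w (If b c1 c2) s t s'"
inductive_cases WhileE: "exec tc w (While b c) s t s'"

lemma exec_deterministic:
  "exec tc w c s t s' \<Longrightarrow> exec tc w c s u s'' \<Longrightarrow> u = t \<and> s'' = s'"
proof (induction arbitrary: u s'' rule: exec.induct)
  case (Skip s)
  from Skip.prems show ?case by (rule SkipE) simp
next
  case (Assign x e s)
  from Assign.prems show ?case by (rule AssignE) simp
next
  case (WSet A i e s)
  from WSet.prems show ?case by (rule WSetE) simp
next
  case (VSet A i e s)
  from VSet.prems show ?case by (rule VSetE) simp
next
  case (Convolve n ne s k ke D S Q)
  from Convolve.prems show ?case unfolding Convolve.hyps(1,2) by (rule ConvolveE) simp
next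
  case (Seq c1 s t1 s1 c2 t2 s2)
  from Seq.prems show ?case by (rule SeqE) (auto dest: Seq.IH)
next
  case (IfTrue b s c1 t s1 c2)
  from IfTrue.prems show ?case by (rule IfE) (auto dest: IfTrue.IH simp: IfTrue.hyps(1))
next
  case (IfFalse b s c2 t s1 c1)
  from IfFalse.prems show ?case by (rule IfE) (auto dest: IfFalse.IH simp: IfFalse.hyps(1))
next
  case (WhileFalse b s c)
  from WhileFalse.prems show ?case by (rule WhileE) (simp_all add: WhileFalse.hyps)
next
  case (WhileTrue b s c t1 s1 t2 s2)
  from WhileTrue.prems show ?case
    by (rule WhileE) (auto dest: WhileTrue.IH simp: WhileTrue.hyps(1))
qed

text \<open>
  \<open>input w T P s\<close>: the initial state \<open>s\<close> holds the trie \<open>T\<close> (as a parent array and an array of edge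
  labels, both indexed by nodes) and the pattern \<open>P\<close>. All other storage contains arbitrary words
  and values.
\<close>

definition input :: "nat \<Rightarrow> trie \<Rightarrow> int list \<Rightarrow> state \<Rightarrow> bool" where
  "input w T P s \<longleftrightarrow>
     (\<forall>x. reg s x < 2 ^ w) \<and> (\<forall>A i. warr s A i < 2 ^ w) \<and>
     reg s ''r'' = trie_size T \<and>
     reg s ''m'' = length P \<and>
     reg s ''root'' = trie_root T \<and>
     (\<forall>v < trie_size T. v \<noteq> trie_root T \<longrightarrow>
        warr s ''parent'' v = parent T v \<and> varr s ''label'' v = edge_label T v) \<and>
     (\<forall>j < length P. varr s ''P'' j = P ! j)"

definition lg :: "nat \<Rightarrow> real" where
  "lg x = max 1 (log 2 (real x))"

text \<open>Convolving vectors of lengths \<open>n\<close> and \<open>k \<le> n\<close> takes \<open>O(n log k)\<close> steps, as by FFT.\<close>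

definition fft_time :: "(nat \<Rightarrow> nat \<Rightarrow> nat) \<Rightarrow> bool" where
  "fft_time tc \<longleftrightarrow>
     (\<exists>\<kappa>::real. \<forall>n k. 0 < k \<longrightarrow> k \<le> n \<longrightarrow> real (tc n k) \<le> \<kappa> * (real n * lg k))"

end

theory Submission
  imports Defs
begin

text \<open>
  Cut the trie into long paths: every inner node is followed by a child of greatest height. Let
  \<open>C v\<close> be the sum to be computed, with labels above the root read as \<open>0\<close>. If \<open>x\<^sub>0, x\<^sub>1, \<dots>\<close> is a long
  path of \<open>h\<close> nodes whose top has parent \<open>p\<close>, then the long path through \<open>p\<close> continues below \<open>p\<close> with
  at least \<open>h\<close> nodes \<open>y\<^sub>0, y\<^sub>1, \<dots>\<close>, where \<open>y\<^sub>a\<close> and \<open>x\<^sub>a\<close> have equal depth and the same ancestors from \<open>p\<close>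
  upwards. Hence \<open>C x\<^sub>a - C y\<^sub>a\<close> only involves the labels on the two paths: it is entry \<open>a\<close> of the
  convolution of the \<open>h\<close> label differences with the last \<open>min h m\<close> characters of the pattern, at
  cost \<open>O(h log m)\<close>. The long paths are disjoint, so these costs add up to \<open>O(r log m)\<close>. Heights are
  found by repeatedly removing leaves, and the reverse of the removal order handles each path
  after the path of the parent of its top.
\<close>

section \<open>Weakest preconditions with running time\<close>

text \<open>The postcondition receives the number of steps along with the final state.\<close>

definition wp :: "(nat \<Rightarrow> nat \<Rightarrow> nat) \<Rightarrow> nat \<Rightarrow> com \<Rightarrow> (nat \<Rightarrow> state \<Rightarrow> bool) \<Rightarrow> state \<Rightarrow> bool" where
  "wp tc w c Q s \<longleftrightarrow> (\<exists>t s'. exec tc w c s t s' \<and> Q t s')"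

lemma wp_Skip [simp]: "wp tc w Skip Q s \<longleftrightarrow> Q 1 s"
  unfolding wp_def
  by (rule iffI; (elim exE conjE SkipE)?; (intro exI conjI, rule exec.Skip)?; simp)

lemma wp_Assign [simp]:
  "wp tc w (Assign x e) Q s \<longleftrightarrow> Q (1 + wcost e) (s\<lparr>reg := (reg s)(x := wval w e s)\<rparr>)"
  unfolding wp_def
  by (rule iffI; (elim exE conjE AssignE)?; (intro exI conjI, rule exec.Assign)?; simp)

lemma wp_WSet [simp]:
  "wp tc w (WSet A i e) Q s \<longleftrightarrow> Q (1 + wcost i + wcost e)
    (s\<lparr>warr := (warr s)(A := (warr s A)(wval w i s := wval w e s))\<rparr>)"
  unfolding wp_def
  by (rule iffI; (elim exE conjE WSetE)?; (intro exI conjI, rule exec.WSet)?; simp)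

lemma wp_VSet [simp]:
  "wp tc w (VSet A i e) Q s \<longleftrightarrow> Q (1 + wcost i + vcost e)
    (s\<lparr>varr := (varr s)(A := (varr s A)(wval w i s := vval w e s))\<rparr>)"
  unfolding wp_def
  by (rule iffI; (elim exE conjE VSetE)?; (intro exI conjI, rule exec.VSet)?; simp)

lemma wp_Convolve:
  assumes "0 < wval w ke s" "wval w ke s \<le> wval w ne s"
    and "Q (1 + wcost ne + wcost ke + tc (wval w ne s) (wval w ke s))
      (s\<lparr>varr := (varr s)(D := (\<lambda>i. if i \<le> wval w ne s - wval w ke s
          then conv (varr s S) (varr s V) (wval w ke s) i else varr s D i))\<rparr>)"
  shows "wp tc w (Convolve D S ne V ke) Q s"
  using exec.Convolve[OF refl refl assms(1,2)] assms(3) unfolding wp_def by blast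

lemma wp_Seq [simp]:
  "wp tc w (Seq c1 c2) Q s \<longleftrightarrow> wp tc w c1 (\<lambda>t1. wp tc w c2 (\<lambda>t2. Q (t1 + t2))) s"
  unfolding wp_def
  by (rule iffI; (elim exE conjE SeqE)?; blast intro: exec.Seq)

lemma wp_If [simp]:
  "wp tc w (If b c1 c2) Q s \<longleftrightarrow>
     (if bval w b s then wp tc w c1 (\<lambda>t. Q (1 + bcost b + t)) s
      else wp tc w c2 (\<lambda>t. Q (1 + bcost b + t)) s)"
proof
  assume "wp tc w (If b c1 c2) Q s"
  then obtain t s' where "exec tc w (If b c1 c2) s t s'" "Q t s'" unfolding wp_def by blast
  then show "if bval w b s then wp tc w c1 (\<lambda>t. Q (1 + bcost b + t)) s
      else wp tc w c2 (\<lambda>t. Q (1 + bcost b + t)) s"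
    unfolding wp_def by (elim IfE) auto
next
  assume "if bval w b s then wp tc w c1 (\<lambda>t. Q (1 + bcost b + t)) s
      else wp tc w c2 (\<lambda>t. Q (1 + bcost b + t)) s"
  then show "wp tc w (If b c1 c2) Q s"
    unfolding wp_def using exec.IfTrue exec.IfFalse by (metis (full_types))
qed

lemma wp_mono:
  assumes "wp tc w c Q s" "\<And>t s'. Q t s' \<Longrightarrow> R t s'"
  shows "wp tc w c R s"
  using assms unfolding wp_def by blast

text \<open>The potential pays for each round including its test. As every round costs at least one
  step, it strictly decreases, so it bounds the running time and proves termination at once.\<close>

lemma wp_While_potential:
  assumes "I s"
    and step: "\<And>s. I s \<Longrightarrow> bval w b s \<Longrightarrow>
      wp tc w c (\<lambda>t s'. I s' \<and> 1 + bcost b + t + \<Phi> s' \<le> \<Phi> s) s"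
  shows "wp tc w (While b c) (\<lambda>t s'. I s' \<and> \<not> bval w b s' \<and> t \<le> \<Phi> s + 1 + bcost b) s"
  using assms(1)
proof (induction "\<Phi> s" arbitrary: s rule: less_induct)
  case less
  show ?case
  proof (cases "bval w b s")
    case True
    from step[OF less.prems True] obtain t s' where 1: "exec tc w c s t s'" "I s'"
      "1 + bcost b + t + \<Phi> s' \<le> \<Phi> s" unfolding wp_def by blast
    then obtain t' s'' where "exec tc w (While b c) s' t' s''" "I s''" "\<not> bval w b s''"
      "t' \<le> \<Phi> s' + 1 + bcost b"
      using less.hyps[of s'] unfolding wp_def by auto
    with 1 exec.WhileTrue[OF True] show ?thesis unfolding wp_def
      by (intro exI[of _ "1 + bcost b + t + t'"] exI[of _ s'']) auto
  next
    case False
    with exec.WhileFalse[of w b s tc c] less.prems show ?thesis unfolding wp_def by fastforce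
  qed
qed

text \<open>Variant for loops whose number \<open>N\<close> of rounds is known in advance: the
  invariant is indexed by the rounds done, and \<open>B\<close> bounds the body of each
  round.\<close>

lemma wp_While_count:
  assumes "I 0 s"
    and step: "\<And>j s. I j s \<Longrightarrow> j < N \<Longrightarrow> bval w b s \<and> wp tc w c (\<lambda>t s'. I (Suc j) s' \<and> t \<le> B) s"
    and stop: "\<And>s. I N s \<Longrightarrow> \<not> bval w b s"
  shows "wp tc w (While b c) (\<lambda>t s'. I N s' \<and> t \<le> N * (1 + bcost b + B) + 1 + bcost b) s"
proof -
  have "wp tc w (While b c)
      (\<lambda>t s'. I N s' \<and> t \<le> (N - j) * (1 + bcost b + B) + 1 + bcost b) s" if "I j s" "j \<le> N" for j s
    using that(2,1)
  proof (induction arbitrary: s rule: inc_induct)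
    case base
    with exec.WhileFalse[OF stop] show ?case unfolding wp_def by fastforce
  next
    case (step j)
    from assms(2)[OF step.prems step.hyps(2)] obtain t s' where
      1: "bval w b s" "exec tc w c s t s'" "I (Suc j) s'" "t \<le> B" unfolding wp_def by blast
    from step.IH[OF 1(3)] obtain t' s'' where "exec tc w (While b c) s' t' s''" "I N s''"
      "t' \<le> (N - Suc j) * (1 + bcost b + B) + 1 + bcost b" unfolding wp_def by blast
    moreover have "N - j = Suc (N - Suc j)" using step.hyps by simp
    ultimately show ?case using exec.WhileTrue[OF 1(1,2)] 1(4) unfolding wp_def
      by (intro exI[of _ "1 + bcost b + t + t'"] exI[of _ s'']) auto
  qed
  from this[of 0 s] assms(1) show ?thesis by simp
qed

section \<open>The program\<close>

notation Seq (infixr ";;" 60)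

abbreviation Inc :: "string \<Rightarrow> com" where
  "Inc x \<equiv> Assign x (WOp Add (Reg x) (WConst 1))"

text \<open>
  Cell \<open>r\<close> of the node arrays serves as a sentinel: a node with label \<open>0\<close> above the root that is
  its own parent and its own long child. The top long path thus needs no special treatment.
\<close>

definition add_sentinel :: com where
  "add_sentinel =
     WSet ''parent'' (Reg ''root'') (Reg ''r'') ;;
     WSet ''parent'' (Reg ''r'') (Reg ''r'') ;;
     VSet ''label'' (Reg ''root'') (VConst 0) ;;
     VSet ''label'' (Reg ''r'') (VConst 0) ;;
     VSet ''out'' (Reg ''r'') (VConst 0)"

text \<open>The count of the sentinel starts at \<open>1\<close>, so that it never enters the queue of leaves.\<close>

definition clear_counters :: com where
  "clear_counters =
     WSet ''cnt'' (Reg ''r'') (WConst 1) ;;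
     WSet ''hgt'' (Reg ''r'') (WConst 0) ;;
     Assign ''i'' (WConst 0) ;;
     While (Less (Reg ''i'') (Reg ''r''))
       (WSet ''cnt'' (Reg ''i'') (WConst 0) ;;
        WSet ''hgt'' (Reg ''i'') (WConst 0) ;;
        Inc ''i'')"

definition count_children :: com where
  "count_children =
     Assign ''i'' (WConst 0) ;;
     While (Less (Reg ''i'') (Reg ''r''))
       (Assign ''p'' (WGet ''parent'' (Reg ''i'')) ;;
        WSet ''cnt'' (Reg ''p'') (WOp Add (WGet ''cnt'' (Reg ''p'')) (WConst 1)) ;;
        Inc ''i'')"

definition enqueue_leaves :: com where
  "enqueue_leaves =
     Assign ''n'' (WConst 0) ;;
     Assign ''i'' (WConst 0) ;;
     While (Less (Reg ''i'') (Reg ''r''))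
       (If (Eq (WGet ''cnt'' (Reg ''i'')) (WConst 0))
         (WSet ''q'' (Reg ''n'') (Reg ''i'') ;; Inc ''n'')
         Skip ;;
        Inc ''i'')"

text \<open>\<open>hgt\<close> is a running maximum over the removed children. The comparison is
  strict, so \<open>long\<close> keeps the first child attaining the maximum. A parent enters the
  queue when its last child is removed.\<close>

definition peel_body :: com where
  "peel_body =
     Assign ''v'' (WGet ''q'' (Reg ''i'')) ;;
     Assign ''p'' (WGet ''parent'' (Reg ''v'')) ;;
     Assign ''d'' (WOp Add (WGet ''hgt'' (Reg ''v'')) (WConst 1)) ;;
     WSet ''cnt'' (Reg ''p'') (WOp Sub (WGet ''cnt'' (Reg ''p'')) (WConst 1)) ;;
     If (Less (WGet ''hgt'' (Reg ''p'')) (Reg ''d''))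
       (WSet ''hgt'' (Reg ''p'') (Reg ''d'') ;; WSet ''long'' (Reg ''p'') (Reg ''v''))
       Skip ;;
     If (Eq (WGet ''cnt'' (Reg ''p'')) (WConst 0))
       (WSet ''q'' (Reg ''n'') (Reg ''p'') ;; Inc ''n'')
       Skip ;;
     Inc ''i''"

definition peel :: com where
  "peel =
     Assign ''i'' (WConst 0) ;;
     While (Less (Reg ''i'') (Reg ''n'')) peel_body ;;
     WSet ''long'' (Reg ''r'') (Reg ''r'')"

text \<open>\<open>Q\<close> receives the last \<open>k\<close> characters. The zeros in cells below
  \<open>k - 1\<close> of \<open>S\<close> are padding; cell \<open>k - 1\<close> is overwritten by
  the first label difference.\<close>

definition load_pattern :: com where
  "load_pattern =
     Assign ''j'' (WConst 0) ;;
     While (Less (Reg ''j'') (Reg ''k''))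
       (VSet ''Q'' (Reg ''j'') (VGet ''P'' (WOp Add (WOp Sub (Reg ''m'') (Reg ''k'')) (Reg ''j''))) ;;
        VSet ''S'' (Reg ''j'') (VConst 0) ;;
        Inc ''j'')"

definition load_differences :: com where
  "load_differences =
     Assign ''j'' (WConst 0) ;;
     Assign ''x'' (Reg ''u'') ;;
     Assign ''z'' (Reg ''y'') ;;
     While (Less (Reg ''j'') (Reg ''h''))
       (VSet ''S'' (WOp Add (WOp Sub (Reg ''k'') (WConst 1)) (Reg ''j''))
          (VOp VSub (VGet ''label'' (Reg ''x'')) (VGet ''label'' (Reg ''z''))) ;;
        Assign ''x'' (WGet ''long'' (Reg ''x'')) ;;
        Assign ''z'' (WGet ''long'' (Reg ''z'')) ;;
        Inc ''j'')"

definition store_path :: com where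
  "store_path =
     Assign ''j'' (WConst 0) ;;
     Assign ''x'' (Reg ''u'') ;;
     Assign ''z'' (Reg ''y'') ;;
     While (Less (Reg ''j'') (Reg ''h''))
       (VSet ''out'' (Reg ''x'') (VOp VAdd (VGet ''out'' (Reg ''z'')) (VGet ''D'' (Reg ''j''))) ;;
        Assign ''x'' (WGet ''long'' (Reg ''x'')) ;;
        Assign ''z'' (WGet ''long'' (Reg ''z'')) ;;
        Inc ''j'')"

text \<open>Entry \<open>a < h\<close> involves only the characters at distance at most
  \<open>a\<close> from the end of the pattern, so \<open>k = min m h\<close> of them suffice. The
  vector in \<open>S\<close> consists of \<open>k - 1\<close> zeros and \<open>h\<close>
  differences, which yields exactly \<open>h\<close> entries.\<close>

definition process_path :: com where
  "process_path =
     Assign ''h'' (WOp Add (WGet ''hgt'' (Reg ''u'')) (WConst 1)) ;;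
     If (Less (Reg ''m'') (Reg ''h'')) (Assign ''k'' (Reg ''m'')) (Assign ''k'' (Reg ''h'')) ;;
     load_pattern ;;
     load_differences ;;
     Convolve ''D'' ''S'' (WOp Sub (WOp Add (Reg ''h'') (Reg ''k'')) (WConst 1)) ''Q'' (Reg ''k'') ;;
     store_path"

text \<open>If \<open>y = u\<close>, then \<open>u\<close> lies inside a long path whose top is an
  ancestor of \<open>u\<close>; that top came earlier in this reversed order and its whole path has
  been written.\<close>

definition process_paths :: com where
  "process_paths =
     While (Less (WConst 0) (Reg ''i''))
       (Assign ''i'' (WOp Sub (Reg ''i'') (WConst 1)) ;;
        Assign ''u'' (WGet ''q'' (Reg ''i'')) ;;
        Assign ''y'' (WGet ''long'' (WGet ''parent'' (Reg ''u''))) ;;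
        If (Eq (Reg ''y'') (Reg ''u'')) Skip process_path)"

definition trie_conv_prog :: com where
  "trie_conv_prog =
     add_sentinel ;; clear_counters ;; count_children ;; enqueue_leaves ;; peel ;; process_paths"

section \<open>Removing leaves\<close>

text \<open>The sentinel is \<open>r\<close>. The function \<open>dep\<close> is a mere measure that
  falls along edges between proper nodes; it is how acyclicity enters.\<close>

locale sentinel_tree =
  fixes r :: nat and par :: "nat \<Rightarrow> nat" and dep :: "nat \<Rightarrow> nat"
  assumes par_le: "v \<le> r \<Longrightarrow> par v \<le> r"
    and par_sentinel: "par r = r"
    and dep_par: "v < r \<Longrightarrow> par v < r \<Longrightarrow> dep (par v) < dep v"
begin

lemma par_neq: "v < r \<Longrightarrow> par v \<noteq> v"
  using dep_par by force

text \<open>One invariant for two phases: while children are counted, \<open>k\<close> grows and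
  \<open>A\<close> is empty; while leaves are removed, \<open>k = r\<close> and \<open>A\<close>
  grows.\<close>

definition counts :: "nat \<Rightarrow> (nat \<Rightarrow> nat) \<Rightarrow> nat set \<Rightarrow> bool" where
  "counts k cnt A \<longleftrightarrow>
     (\<forall>v \<le> r. cnt v = card {c. c < k \<and> par c = v \<and> c \<notin> A} + (if v = r then 1 else 0))"

text \<open>
  The first \<open>i\<close> of the \<open>n\<close> nodes in the queue \<open>q\<close> have been removed; \<open>H\<close> and \<open>L\<close> are the heights and
  long children with respect to the removed nodes.
\<close>

definition peeled :: "nat \<Rightarrow> nat \<Rightarrow> (nat \<Rightarrow> nat) \<Rightarrow> (nat \<Rightarrow> nat) \<Rightarrow> (nat \<Rightarrow> nat) \<Rightarrow> (nat \<Rightarrow> nat) \<Rightarrow> bool" where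
  "peeled i n cnt q H L \<longleftrightarrow>
     i \<le> n \<and> inj_on q {..<n} \<and> q ` {..<n} = {v. v < r \<and> cnt v = 0} \<and>
     counts r cnt (q ` {..<i}) \<and>
     (\<forall>j < i. \<forall>l < n. q l = par (q j) \<longrightarrow> j < l) \<and>
     (\<forall>j < i. H (q j) < H (par (q j))) \<and>
     (\<forall>p \<le> r. 0 < H p \<longrightarrow> L p \<in> q ` {..<i} \<and> par (L p) = p \<and> H p = Suc (H (L p))) \<and>
     (\<forall>p \<le> r. H p \<le> i)"

lemma peeled_le: "peeled i n cnt q H L \<Longrightarrow> n \<le> r"
proof -
  assume "peeled i n cnt q H L"
  then have "inj_on q {..<n}" "q ` {..<n} \<subseteq> {..<r}" unfolding peeled_def by auto
  from card_inj_on_le[OF this] show "n \<le> r" by simp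
qed

text \<open>The next node to be removed is still counted at its parent, so the parent has a positive
  count and cannot be in the queue yet.\<close>

lemma peeled_parent:
  assumes "peeled i n cnt q H L" "i < n"
  shows "q i < r" "par (q i) \<le> r" "0 < cnt (par (q i))" "q i \<noteq> par (q i)"
    "par (q i) \<notin> q ` {..<n}" "q i \<notin> q ` {..<i}"
proof -
  have 1: "q i \<in> q ` {..<n}" "inj_on q {..<n}" "q ` {..<n} = {v. v < r \<and> cnt v = 0}"
    "counts r cnt (q ` {..<i})"
    using assms unfolding peeled_def by auto
  show 2: "q i < r" using 1 by auto
  show 3: "par (q i) \<le> r" using 2 par_le by simp
  show "q i \<noteq> par (q i)" using 2 par_neq by force
  show 4: "q i \<notin> q ` {..<i}" using inj_onD[OF 1(2)] assms(2) by fastforce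
  have "q i \<in> {c. c < r \<and> par c = par (q i) \<and> c \<notin> q ` {..<i}}" using 2 4 by auto
  then have "0 < card {c. c < r \<and> par c = par (q i) \<and> c \<notin> q ` {..<i}}"
    by (subst card_gt_0_iff) auto
  then show "0 < cnt (par (q i))" using 1(4) 3 unfolding counts_def by auto
  then show "par (q i) \<notin> q ` {..<n}" using 1(3) by auto
qed

lemma counts_remove:
  assumes "counts r cnt A" "v < r" "v \<notin> A"
  shows "counts r (cnt(par v := cnt (par v) - 1)) (insert v A)"
  unfolding counts_def
proof (intro allI impI)
  fix p assume p: "p \<le> r"
  show "(cnt(par v := cnt (par v) - 1)) p
      = card {c. c < r \<and> par c = p \<and> c \<notin> insert v A} + (if p = r then 1 else 0)"
  proof (cases "p = par v")
    case True
    have "{c. c < r \<and> par c = p \<and> c \<notin> insert v A} = {c. c < r \<and> par c = p \<and> c \<notin> A} - {v}"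
      by auto
    moreover have "v \<in> {c. c < r \<and> par c = p \<and> c \<notin> A}" using True assms by auto
    moreover from this have "0 < card {c. c < r \<and> par c = p \<and> c \<notin> A}"
      by (subst card_gt_0_iff) auto
    ultimately show ?thesis using assms(1) p True unfolding counts_def by auto
  next
    case False
    then have "{c. c < r \<and> par c = p \<and> c \<notin> insert v A} = {c. c < r \<and> par c = p \<and> c \<notin> A}" by auto
    then show ?thesis using assms(1) p False unfolding counts_def by auto
  qed
qed

text \<open>The parent \<open>p\<close> is not yet queued: appending it keeps \<open>q\<close>
  injective, and changing its height affects no queued node. The conditional hypotheses match the
  four ways through the loop body.\<close>

lemma peeled_step:
  assumes pe: "peeled i n cnt q H L" and i: "i < n"
    and p: "p = par (q i)"
    and cnt': "cnt' = cnt(p := cnt p - 1)"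
    and HL: "if H p < Suc (H (q i)) then H' = H(p := Suc (H (q i))) \<and> L' = L(p := q i)
             else H' = H \<and> L' = L"
    and qn: "if cnt' p = 0 then q' = q(n := p) \<and> n' = Suc n else q' = q \<and> n' = n"
  shows "peeled (Suc i) n' cnt' q' H' L'"
proof -
  note F = peeled_parent[OF pe i, folded p]
  have D: "inj_on q {..<n}" "q ` {..<n} = {v. v < r \<and> cnt v = 0}" "counts r cnt (q ` {..<i})"
    "\<forall>j < i. \<forall>l < n. q l = par (q j) \<longrightarrow> j < l"
    "\<forall>j < i. H (q j) < H (par (q j))"
    "\<forall>p \<le> r. 0 < H p \<longrightarrow> L p \<in> q ` {..<i} \<and> par (L p) = p \<and> H p = Suc (H (L p))"
    "\<forall>p \<le> r. H p \<le> i"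
    using pe unfolding peeled_def by auto
  have q'_old: "q' j = q j" if "j < n" for j using that qn by (auto split: if_splits)
  have im: "q' ` {..<Suc i} = insert (q i) (q ` {..<i})"
    using q'_old i by (auto simp: lessThan_Suc image_iff)
  have cs: "counts r cnt' (q' ` {..<Suc i})"
    unfolding im cnt' p using counts_remove[OF D(3) F(1,6)] by simp
  \<comment> \<open>The extra \<open>1\<close> in the count of the sentinel keeps it out of the
    queue.\<close>
  have cr: "p = r \<Longrightarrow> cnt' p \<noteq> 0" using cs unfolding counts_def by auto
  have im2: "q' ` {..<n'} = {v. v < r \<and> cnt' v = 0}"
  proof (cases "cnt' p = 0")
    case True
    then have "p < r" using cr F(2) by (cases "p = r") auto
    moreover have "q' ` {..<n'} = insert p (q ` {..<n})"
      using True qn q'_old by (auto simp: lessThan_Suc image_iff)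
    ultimately show ?thesis using True D(2) cnt' by auto
  next
    case False
    then have "q' ` {..<n'} = q ` {..<n}" using qn by simp
    then show ?thesis unfolding D(2) using False cnt' F(3) by auto
  qed
  have inj: "inj_on q' {..<n'}"
    using qn D(1) F(5) by (auto split: if_splits simp: lessThan_Suc inj_on_def image_iff)
  have n': "n \<le> n'" using qn by (auto split: if_splits)
  have top: "\<forall>j < Suc i. \<forall>l < n'. q' l = par (q' j) \<longrightarrow> j < l"
  proof (intro allI impI)
    fix j l assume jl: "j < Suc i" "l < n'" "q' l = par (q' j)"
    show "j < l"
    proof (cases "l < n")
      case True
      then have "q l = par (q j)" using jl q'_old i by simp
      moreover from this True have "j \<noteq> i" using F(5) p by (metis imageI lessThan_iff)
      ultimately show ?thesis using D(4) jl True by auto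
    next
      case False
      then show ?thesis using jl i by simp
    qed
  qed
  have Hle: "H v \<le> H' v" for v using HL by (auto split: if_splits)
  \<comment> \<open>Heights are final once a node is queued.\<close>
  have Hq: "H' (q j) = H (q j)" if "j < n" for j using that F(5) HL by (auto split: if_splits)
  have HH: "\<forall>j < Suc i. H' (q' j) < H' (par (q' j))"
  proof (intro allI impI)
    fix j assume j: "j < Suc i"
    show "H' (q' j) < H' (par (q' j))"
    proof (cases "j = i")
      case True
      then show ?thesis using HL Hq[OF i] q'_old[OF i] p by (auto split: if_splits)
    next
      case False
      then have "H (q j) < H (par (q j))" using D(5) j by auto
      then show ?thesis using Hq[of j] q'_old[of j] Hle[of "par (q j)"] i j by auto
    qed
  qed
  have LL: "\<forall>x \<le> r. 0 < H' x \<longrightarrow>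
      L' x \<in> q' ` {..<Suc i} \<and> par (L' x) = x \<and> H' x = Suc (H' (L' x))"
  proof (intro allI impI)
    fix x assume x: "x \<le> r" "0 < H' x"
    show "L' x \<in> q' ` {..<Suc i} \<and> par (L' x) = x \<and> H' x = Suc (H' (L' x))"
    proof (cases "x = p \<and> H p < Suc (H (q i))")
      case True
      then show ?thesis unfolding im using HL p F(4) by auto
    next
      case False
      then have e: "H' x = H x" "L' x = L x" using HL by (auto split: if_splits)
      then have "L x \<in> q ` {..<i}" "par (L x) = x" "H x = Suc (H (L x))" using D(6) x by auto
      then show ?thesis unfolding im e using Hq i by auto
    qed
  qed
  have "\<forall>x \<le> r. H' x \<le> Suc i"
    using D(7) HL F(1) by (auto split: if_splits simp: le_SucI)
  then show ?thesis unfolding peeled_def using i n' inj im2 cs top HH LL by auto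
qed

text \<open>The outcome of the removal phase: \<open>q\<close> lists every node before its parent,
  and the two clauses on \<open>H\<close> make it the height function, attained through the long
  child \<open>L p\<close>.\<close>

definition long_paths :: "(nat \<Rightarrow> nat) \<Rightarrow> (nat \<Rightarrow> nat) \<Rightarrow> (nat \<Rightarrow> nat) \<Rightarrow> bool" where
  "long_paths q H L \<longleftrightarrow>
     bij_betw q {..<r} {..<r} \<and>
     (\<forall>j < r. par (q j) = r \<or> (\<exists>l < r. j < l \<and> q l = par (q j))) \<and>
     (\<forall>v < r. H v < H (par v)) \<and>
     (\<forall>p < r. 0 < H p \<longrightarrow> L p < r \<and> par (L p) = p \<and> H p = Suc (H (L p))) \<and>
     (\<forall>p \<le> r. H p \<le> r) \<and> L r = r"

text \<open>Were some node left over, a deepest such node would have all its children removed, hence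
  count \<open>0\<close>, and would be in the queue.\<close>

lemma peeled_done:
  assumes pe: "peeled n n cnt q H L"
  shows "n = r" "long_paths q H (L(r := r))"
proof -
  have D: "inj_on q {..<n}" "q ` {..<n} = {v. v < r \<and> cnt v = 0}" "counts r cnt (q ` {..<n})"
    "\<forall>j < n. \<forall>l < n. q l = par (q j) \<longrightarrow> j < l"
    "\<forall>j < n. H (q j) < H (par (q j))"
    "\<forall>p \<le> r. 0 < H p \<longrightarrow> L p \<in> q ` {..<n} \<and> par (L p) = p \<and> H p = Suc (H (L p))"
    "\<forall>p \<le> r. H p \<le> n"
    using pe unfolding peeled_def by auto
  have all: "q ` {..<n} = {..<r}"
  proof (rule ccontr)
    define U where "U = {..<r} - q ` {..<n}"
    assume "q ` {..<n} \<noteq> {..<r}"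
    then have "U \<noteq> {}" "finite U" unfolding U_def D(2) by auto
    then obtain v where v: "v \<in> U" "\<forall>c \<in> U. dep c \<le> dep v"
      using Max_in[of "dep ` U"] Max_ge[of "dep ` U"] by fastforce
    have "{c. c < r \<and> par c = v \<and> c \<notin> q ` {..<n}} = {}"
    proof -
      have "c \<notin> U" if "c < r" "par c = v" for c
        using v dep_par[of c] that unfolding U_def by (metis Diff_iff lessThan_iff not_le)
      then show ?thesis unfolding U_def by auto
    qed
    then have "cnt v = 0" using D(3) v(1) unfolding counts_def U_def by simp
    then show False using v(1) unfolding U_def D(2) by simp
  qed
  from card_image[OF D(1)] show n: "n = r" by (simp add: all)
  have bij: "bij_betw q {..<r} {..<r}" using D(1) all n by (simp add: bij_betw_def)
  have "par (q j) = r \<or> (\<exists>l < r. j < l \<and> q l = par (q j))" if j: "j < r" for j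
  proof (cases "par (q j) = r")
    case False
    have "q j < r" using all j n by blast
    then have "par (q j) \<in> q ` {..<n}" using False par_le[of "q j"] all by auto
    then obtain l where "l < n" "q l = par (q j)" by auto
    then show ?thesis using D(4) j n by auto
  qed simp
  moreover have "H v < H (par v)" if "v < r" for v
  proof -
    from that all obtain j where "j < n" "v = q j" by auto
    with D(5) show ?thesis by auto
  qed
  moreover have "L p < r \<and> par (L p) = p \<and> H p = Suc (H (L p))" if "p < r" "0 < H p" for p
    using D(6) that all by auto
  ultimately show "long_paths q H (L(r := r))"
    unfolding long_paths_def using bij D(7) n by auto
qed

end

section \<open>Sums along ancestors\<close>

text \<open>The sum \<open>C v\<close> of the overview, indexed by the distance \<open>q\<close>
  climbed from \<open>v\<close>. With a sentinel of label \<open>0\<close> it makes sense at every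
  depth.\<close>

definition weighted :: "(nat \<Rightarrow> nat) \<Rightarrow> (nat \<Rightarrow> int) \<Rightarrow> int list \<Rightarrow> nat \<Rightarrow> int" where
  "weighted par lab P v =
     (\<Sum>q < length P. lab ((par ^^ q) v) * P ! (length P - 1 - q))"

lemma funpow_descend:
  assumes "\<And>a. a < h \<Longrightarrow> par (x (Suc a)) = x a" "a \<le> h" "q \<le> a"
  shows "(par ^^ q) (x a) = x (a - q)"
  using assms(3)
proof (induction q)
  case (Suc q)
  then have "a - q = Suc (a - Suc q)" by simp
  then show ?case using Suc assms(1)[of "a - Suc q"] assms(2) by simp
qed simp

text \<open>More than \<open>a\<close> steps above \<open>x a\<close> and \<open>y a\<close> the
  ancestors coincide, so those terms cancel and only the labels on the two paths remain.\<close>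

lemma weighted_fork:
  assumes x: "\<And>a. a < h \<Longrightarrow> par (x (Suc a)) = x a"
    and y: "\<And>a. a < h \<Longrightarrow> par (y (Suc a)) = y a"
    and xy: "par (x 0) = par (y 0)" and a: "a \<le> h"
  shows "weighted par lab P (x a) = weighted par lab P (y a) +
    (\<Sum>q | q < length P \<and> q \<le> a. (lab (x (a - q)) - lab (y (a - q))) * P ! (length P - 1 - q))"
proof -
  have "weighted par lab P (x a) - weighted par lab P (y a) = (\<Sum>q < length P.
      (lab ((par ^^ q) (x a)) - lab ((par ^^ q) (y a))) * P ! (length P - 1 - q))"
    unfolding weighted_def by (simp add: sum_subtractf left_diff_distrib)
  also have "\<dots> = (\<Sum>q < length P. if q \<le> a
      then (lab (x (a - q)) - lab (y (a - q))) * P ! (length P - 1 - q) else 0)"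
  proof (rule sum.cong[OF refl])
    fix q
    have "(par ^^ q) (x a) = (par ^^ q) (y a)" if "\<not> q \<le> a"
    proof -
      \<comment> \<open>Climb \<open>a\<close> steps to the tops, one step to the common parent, and
        \<open>d\<close> more.\<close>
      from that obtain d where q: "q = d + (1 + a)" by (metis add.commute le_add_diff_inverse not_less_eq_eq plus_1_eq_Suc)
      show ?thesis unfolding q funpow_add o_apply
        using funpow_descend[where par = par and x = x, OF x a order_refl]
          funpow_descend[where par = par and x = y, OF y a order_refl] xy by simp
    qed
    then show "(lab ((par ^^ q) (x a)) - lab ((par ^^ q) (y a))) * P ! (length P - 1 - q) =
        (if q \<le> a then (lab (x (a - q)) - lab (y (a - q))) * P ! (length P - 1 - q) else 0)"
      using funpow_descend[where par = par and x = x, OF x a]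
        funpow_descend[where par = par and x = y, OF y a] by auto
  qed
  also have "\<dots> = (\<Sum>q | q < length P \<and> q \<le> a.
      (lab (x (a - q)) - lab (y (a - q))) * P ! (length P - 1 - q))"
    by (subst sum.inter_filter[symmetric]) (auto intro!: sum.cong)
  finally show ?thesis by simp
qed

text \<open>Reversing the summation index by \<open>j = k - 1 - q\<close> pairs the character at
  distance \<open>q\<close> from the end with \<open>d (a - q)\<close>, or with a padding zero if
  \<open>q > a\<close>. If \<open>k\<close> is shorter than the pattern, then \<open>a < k\<close>,
  so no term is lost by the truncation.\<close>

lemma conv_padded:
  assumes k: "0 < k" "k \<le> length P" and a: "k = length P \<or> a < k"
    and Q: "\<And>j. j < k \<Longrightarrow> VQ j = P ! (length P - k + j)"
    and S0: "\<And>j. j < k - 1 \<Longrightarrow> VS j = 0"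
    and S: "\<And>b. b \<le> a \<Longrightarrow> VS (k - 1 + b) = d b"
  shows "conv VS VQ k a = (\<Sum>q | q < length P \<and> q \<le> a. d (a - q) * P ! (length P - 1 - q))"
proof -
  have "conv VS VQ k a = (\<Sum>q<k. VQ (k - Suc q) * VS (a + (k - Suc q)))"
    unfolding conv_def by (rule sum.nat_diff_reindex[symmetric])
  also have "\<dots> = (\<Sum>q<k. if q \<le> a then d (a - q) * P ! (length P - 1 - q) else 0)"
  proof (rule sum.cong[OF refl])
    fix q assume "q \<in> {..<k}"
    then have q: "q < k" by simp
    have 1: "VQ (k - Suc q) = P ! (length P - 1 - q)"
      using Q[of "k - Suc q"] q k by simp
    show "VQ (k - Suc q) * VS (a + (k - Suc q)) =
        (if q \<le> a then d (a - q) * P ! (length P - 1 - q) else 0)"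
    proof (cases "q \<le> a")
      case True
      then have "a + (k - Suc q) = k - 1 + (a - q)" using q by simp
      then show ?thesis using S[of "a - q"] True 1 by simp
    next
      case False
      then show ?thesis using S0[of "a + (k - Suc q)"] q by simp
    qed
  qed
  also have "\<dots> = (\<Sum>q | q < k \<and> q \<le> a. d (a - q) * P ! (length P - 1 - q))"
    by (subst sum.inter_filter[symmetric]) (auto intro!: sum.cong)
  also have "{q. q < k \<and> q \<le> a} = {q. q < length P \<and> q \<le> a}" using a k by auto
  finally show ?thesis .
qed

section \<open>From tries to trees with a sentinel\<close>

lemma root_str_nth:
  assumes "j < depth T v"
  shows "root_str T v ! j = edge_label T ((parent T ^^ (depth T v - 1 - j)) v)"
  using assms unfolding root_str_def by (simp add: rev_nth)

text \<open>On the nodes and the sentinel \<open>trie_size T\<close>, this is the parent array as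
  left by \<open>add_sentinel\<close>.\<close>

definition sparent :: "trie \<Rightarrow> nat \<Rightarrow> nat" where
  "sparent T v = (if v = trie_root T \<or> trie_size T \<le> v then trie_size T else parent T v)"

definition slabel :: "trie \<Rightarrow> nat \<Rightarrow> int" where
  "slabel T v = (if v = trie_root T \<or> trie_size T \<le> v then 0 else edge_label T v)"

lemma sparent_funpow:
  assumes T: "is_trie T" and v: "v < trie_size T" and q: "q \<le> depth T v"
  shows "(sparent T ^^ q) v = (parent T ^^ q) v \<and> (parent T ^^ q) v < trie_size T"
  using q
proof (induction q)
  case (Suc q)
  then have "q < depth T v" by simp
  then have "(parent T ^^ q) v \<noteq> trie_root T" unfolding depth_def by (rule not_less_Least)
  then show ?case using Suc T unfolding sparent_def is_trie_def by auto
qed (use v in simp)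

text \<open>At depth at least \<open>length P\<close>, the climb reads only edges below the root, so
  the sentinel convention does not show; the string is read backwards.\<close>

lemma trie_conv_weighted:
  assumes T: "is_trie T" and v: "v < trie_size T" and d: "length P \<le> depth T v"
  shows "trie_conv T P v = weighted (sparent T) (slabel T) P v"
proof -
  have "trie_conv T P v = (\<Sum>j<length P. str T v (length P) ! j * P ! j)"
    unfolding trie_conv_def by (simp add: sum.atLeast1_atMost_eq)
  also have "\<dots> = (\<Sum>q<length P. str T v (length P) ! (length P - Suc q) * P ! (length P - Suc q))"
    by (rule sum.nat_diff_reindex[symmetric])
  also have "\<dots> = weighted (sparent T) (slabel T) P v"
    unfolding weighted_def
  proof (rule sum.cong[OF refl])
    fix q assume "q \<in> {..<length P}"
    then have q: "q < length P" by simp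
    have "length (root_str T v) = depth T v" unfolding root_str_def by simp
    then have "str T v (length P) ! (length P - Suc q)
        = root_str T v ! (depth T v - length P + (length P - Suc q))"
      unfolding str_def using d by (subst nth_drop) auto
    also have "depth T v - length P + (length P - Suc q) = depth T v - Suc q" using q d by simp
    also have "root_str T v ! (depth T v - Suc q) = edge_label T ((parent T ^^ q) v)"
      using root_str_nth[of "depth T v - Suc q" T v] q d by simp
    also have "\<dots> = slabel T ((sparent T ^^ q) v)"
    proof -
      have "q < depth T v" using q d by simp
      then have "(parent T ^^ q) v \<noteq> trie_root T" unfolding depth_def by (rule not_less_Least)
      then show ?thesis using sparent_funpow[OF T v, of q] q d unfolding slabel_def by simp
    qed
    finally show "str T v (length P) ! (length P - Suc q) * P ! (length P - Suc q) =
        slabel T ((sparent T ^^ q) v) * P ! (length P - 1 - q)" by simp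
  qed
  finally show ?thesis .
qed

lemma depth_parent:
  assumes T: "is_trie T" and v: "v < trie_size T" "v \<noteq> trie_root T"
  shows "depth T (parent T v) < depth T v"
proof -
  from T v obtain d where "(parent T ^^ d) v = trie_root T" unfolding is_trie_def by blast
  then have "(parent T ^^ depth T v) v = trie_root T" unfolding depth_def by (rule LeastI)
  moreover from this v(2) obtain e where e: "depth T v = Suc e" by (cases "depth T v") auto
  ultimately have "(parent T ^^ e) (parent T v) = trie_root T" by (simp add: funpow_swap1)
  then have "depth T (parent T v) \<le> e" unfolding depth_def[of T "parent T v"] by (rule Least_le)
  then show ?thesis using e by simp
qed

lemma sentinel_tree_sparent: "is_trie T \<Longrightarrow> sentinel_tree (trie_size T) (sparent T) (depth T)"
  using depth_parent[of T] unfolding sentinel_tree_def sparent_def is_trie_def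
  by (auto simp: less_imp_le split: if_splits)

section \<open>Decomposition into long paths\<close>

context sentinel_tree
begin

text \<open>A node whose parent is the sentinel also counts as a top, because
  \<open>L r = r\<close>.\<close>

definition path_top :: "(nat \<Rightarrow> nat) \<Rightarrow> nat \<Rightarrow> bool" where
  "path_top L u \<longleftrightarrow> L (par u) \<noteq> u"

context
  fixes q H L assumes lp: "long_paths q H L"
begin

lemma long_child: "p < r \<Longrightarrow> 0 < H p \<Longrightarrow> L p < r \<and> par (L p) = p \<and> H p = Suc (H (L p))"
  using lp unfolding long_paths_def by blast

lemma long_descend:
  assumes "v < r" "a \<le> H v"
  shows "(L ^^ a) v < r \<and> H v = H ((L ^^ a) v) + a \<and> (0 < a \<longrightarrow> par ((L ^^ a) v) = (L ^^ (a - 1)) v)"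
  using assms(2)
proof (induction a)
  case (Suc a)
  then show ?case using long_child[of "(L ^^ a) v"] by auto
qed (use assms in simp)

text \<open>The sum counts the pairs of a top and a position on its path. These pairs map
  injectively to nodes, since long paths are disjoint.\<close>

lemma sum_path_lengths: "(\<Sum>u | u < r \<and> path_top L u. Suc (H u)) \<le> r"
proof -
  define A where "A = (SIGMA u : {u. u < r \<and> path_top L u}. {..H u})"
  have "inj_on (\<lambda>(u, a). (L ^^ a) u) A"
  proof -
    \<comment> \<open>Climb from the common node until the shorter path reaches its top; a top is
      nobody's long child, so the other path must end there as well.\<close>
    have *: "u = u' \<and> a = a'" if "(u, a) \<in> A" "(u', a') \<in> A" "(L ^^ a) u = (L ^^ a') u'" "a \<le> a'"
      for u u' a a'
      using that
    proof (induction a arbitrary: a')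
      case 0
      show ?case
      proof (cases a')
        case (Suc b)
        then have "path_top L ((L ^^ Suc b) u')" using 0 unfolding A_def by simp
        moreover have "u' < r" "Suc b \<le> H u'" using 0 Suc unfolding A_def by auto
        ultimately show ?thesis using long_descend[of u' "Suc b"] unfolding path_top_def by simp
      qed (use 0 in simp)
    next
      case (Suc a)
      from Suc.prems obtain b where b: "a' = Suc b" "a \<le> b" by (cases a') auto
      have "u < r" "Suc a \<le> H u" "u' < r" "Suc b \<le> H u'" using Suc.prems b unfolding A_def by auto
      with Suc.prems(3) b have "(L ^^ a) u = (L ^^ b) u'"
        using long_descend[of u "Suc a"] long_descend[of u' "Suc b"] by (metis diff_Suc_1 zero_less_Suc)
      moreover have "(u, a) \<in> A" "(u', b) \<in> A" using Suc.prems b unfolding A_def by auto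
      ultimately show ?case using Suc.IH[of b] b by simp
    qed
    show ?thesis
    proof (rule inj_onI, clarify)
      fix u a u' a' assume "(u, a) \<in> A" "(u', a') \<in> A" "(L ^^ a) u = (L ^^ a') u'"
      then show "u = u' \<and> a = a'" using *[of u a u' a'] *[of u' a' u a] by (cases "a \<le> a'") auto
    qed
  qed
  moreover have "(\<lambda>(u, a). (L ^^ a) u) ` A \<subseteq> {..<r}"
    using long_descend unfolding A_def by auto
  ultimately have "card A \<le> card {..<r}" by (rule card_inj_on_le) simp
  moreover have "card A = (\<Sum>u | u < r \<and> path_top L u. Suc (H u))"
    unfolding A_def by (subst card_SigmaI) auto
  ultimately show ?thesis by simp
qed

text \<open>The comparison path starts at the long child of \<open>par u\<close>. Since
  \<open>H u < H (par u)\<close>, it is long enough; if \<open>par u = r\<close>, it stays at the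
  sentinel.\<close>

lemma weighted_long_path:
  assumes u: "u < r" and a: "a \<le> H u" and lab: "lab r = 0"
  shows "weighted par lab P ((L ^^ a) u) = weighted par lab P ((L ^^ Suc a) (par u)) +
    (\<Sum>q | q < length P \<and> q \<le> a. (lab ((L ^^ (a - q)) u) - lab ((L ^^ Suc (a - q)) (par u)))
       * P ! (length P - 1 - q))"
proof (rule weighted_fork[where x = "\<lambda>a. (L ^^ a) u" and y = "\<lambda>a. (L ^^ Suc a) (par u)" and h = "H u"])
  show "par ((L ^^ Suc a) u) = (L ^^ a) u" if "a < H u" for a
    using long_descend[of u "Suc a"] u that by simp
  have Lr: "L r = r" and H: "H u < H (par u)" using lp u unfolding long_paths_def by auto
  have y: "par ((L ^^ Suc a) (par u)) = (L ^^ a) (par u)" if "a \<le> H u" for a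
  proof (cases "par u = r")
    case True
    have "(L ^^ b) r = r" for b by (induction b) (simp_all add: Lr)
    then show ?thesis using True par_sentinel Lr by simp
  next
    case False
    then have "par u < r" using par_le[of u] u by simp
    then show ?thesis using long_descend[of "par u" "Suc a"] that H by simp
  qed
  show "par ((L ^^ Suc (Suc a)) (par u)) = (L ^^ Suc a) (par u)" if "a < H u" for a
    using y[of "Suc a"] that by simp
  show "par ((L ^^ 0) u) = par ((L ^^ Suc 0) (par u))" using y[of 0] by simp
qed (rule a)

end

end

section \<open>Correctness and running time\<close>

locale trie_run = sentinel_tree +
  fixes lab :: "nat \<Rightarrow> int" and P :: "int list" and w :: nat and tc :: "nat \<Rightarrow> nat \<Rightarrow> nat"
  assumes pattern: "P \<noteq> []" and lab_sentinel: "lab r = 0" and room: "4 * (r + length P) \<le> 2 ^ w"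
begin

text \<open>The facts that all phases after \<open>add_sentinel\<close> preserve. The output
  \<open>0\<close> at the sentinel is the starting value for the top long path.\<close>

definition env :: "state \<Rightarrow> bool" where
  "env s \<longleftrightarrow> reg s ''r'' = r \<and> reg s ''m'' = length P \<and>
     (\<forall>v \<le> r. warr s ''parent'' v = par v \<and> varr s ''label'' v = lab v) \<and>
     (\<forall>j < length P. varr s ''P'' j = P ! j) \<and> varr s ''out'' r = 0"

lemma room': "4 * r + 4 \<le> 2 ^ w" "0 < w"
proof -
  have "1 \<le> length P" using pattern by (simp add: Suc_le_eq)
  then have "4 * r + 4 \<le> 4 * (r + length P)" by simp
  also note room
  finally show "4 * r + 4 \<le> 2 ^ w" .
  then show "0 < w" by (cases w) auto
qed

lemma weighted_sentinel: "weighted par lab P r = 0"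
proof -
  have "(par ^^ a) r = r" for a by (induction a) (simp_all add: par_sentinel)
  then show ?thesis unfolding weighted_def by (simp add: lab_sentinel)
qed

lemma wp_clear_counters:
  assumes "env s"
  shows "wp tc w clear_counters (\<lambda>t s'. t \<le> 20 * r + 20 \<and> env s' \<and>
    counts 0 (warr s' ''cnt'') {} \<and> (\<forall>v \<le> r. warr s' ''hgt'' v = 0)) s"
proof -
  define I where "I j s \<longleftrightarrow> env s \<and> reg s ''i'' = j \<and> warr s ''cnt'' r = 1 \<and> warr s ''hgt'' r = 0 \<and>
    (\<forall>v < j. warr s ''cnt'' v = 0 \<and> warr s ''hgt'' v = 0)" for j s
  have loop: "I 0 s' \<Longrightarrow> wp tc w (While (Less (Reg ''i'') (Reg ''r''))
      (WSet ''cnt'' (Reg ''i'') (WConst 0) ;; WSet ''hgt'' (Reg ''i'') (WConst 0) ;; Inc ''i''))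
      (\<lambda>t s'. I r s' \<and> t \<le> r * (1 + bcost (Less (Reg ''i'') (Reg ''r'')) + 10)
         + 1 + bcost (Less (Reg ''i'') (Reg ''r''))) s'" for s'
    by (rule wp_While_count) (use room' in \<open>auto simp: I_def env_def less_Suc_eq\<close>)
  have all_le: "(\<forall>v \<le> r. Q v) \<longleftrightarrow> Q r \<and> (\<forall>v < r. Q v)" for Q
    by (auto simp: le_less)
  show ?thesis
    unfolding clear_counters_def wp_Seq wp_Assign wp_WSet
    by (rule wp_mono[OF loop]) (use assms room' in \<open>simp_all add: I_def env_def counts_def all_le\<close>)
qed

lemma wp_count_children:
  assumes "env s" "counts 0 (warr s ''cnt'') {}" "\<forall>v \<le> r. warr s ''hgt'' v = 0"
  shows "wp tc w count_children (\<lambda>t s'. t \<le> 30 * r + 20 \<and> env s' \<and>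
    counts r (warr s' ''cnt'') {} \<and> (\<forall>v \<le> r. warr s' ''hgt'' v = 0)) s"
proof -
  define I where "I j s \<longleftrightarrow> env s \<and> reg s ''i'' = j \<and> counts j (warr s ''cnt'') {} \<and>
    (\<forall>v \<le> r. warr s ''hgt'' v = 0)" for j s
  have step: "counts (Suc j) (cnt(par j := Suc (cnt (par j)))) {}" if "counts j cnt {}" for j cnt
  proof -
    have "{c. c < Suc j \<and> par c = par j} = insert j {c. c < j \<and> par c = par j}" by auto
    moreover have "{c. c < Suc j \<and> par c = v} = {c. c < j \<and> par c = v}" if "v \<noteq> par j" for v
      using that by (auto simp: less_Suc_eq)
    ultimately show ?thesis using that unfolding counts_def by auto
  qed
  \<comment> \<open>Rules out wrap-around in the increment.\<close>
  have bound: "Suc (cnt (par j)) < 2 ^ w" if "counts j cnt {}" "j < r" for j cnt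
  proof -
    have "card {c. c < j \<and> par c = par j} \<le> card {..<j}" by (rule card_mono) auto
    then show ?thesis using that par_le[of j] room' unfolding counts_def by auto
  qed
  have loop: "I 0 s' \<Longrightarrow> wp tc w (While (Less (Reg ''i'') (Reg ''r''))
       (Assign ''p'' (WGet ''parent'' (Reg ''i'')) ;;
        WSet ''cnt'' (Reg ''p'') (WOp Add (WGet ''cnt'' (Reg ''p'')) (WConst 1)) ;;
        Inc ''i''))
      (\<lambda>t s'. I r s' \<and> t \<le> r * (1 + bcost (Less (Reg ''i'') (Reg ''r'')) + 20)
         + 1 + bcost (Less (Reg ''i'') (Reg ''r''))) s'" for s'
    by (rule wp_While_count) (use room' in \<open>auto simp: I_def env_def step bound\<close>)
  show ?thesis
    unfolding count_children_def wp_Seq wp_Assign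
    by (rule wp_mono[OF loop]) (use assms room' in \<open>simp_all add: I_def env_def\<close>)
qed

lemma wp_enqueue_leaves:
  assumes "env s" "counts r (warr s ''cnt'') {}" "\<forall>v \<le> r. warr s ''hgt'' v = 0"
  shows "wp tc w enqueue_leaves (\<lambda>t s'. t \<le> 40 * r + 20 \<and> env s' \<and>
    peeled 0 (reg s' ''n'') (warr s' ''cnt'') (warr s' ''q'') (warr s' ''hgt'') (warr s' ''long'')) s"
proof -
  define I where "I j s \<longleftrightarrow> env s \<and> reg s ''i'' = j \<and> counts r (warr s ''cnt'') {} \<and>
    (\<forall>v \<le> r. warr s ''hgt'' v = 0) \<and> reg s ''n'' \<le> j \<and> inj_on (warr s ''q'') {..<reg s ''n''} \<and>
    warr s ''q'' ` {..<reg s ''n''} = {v. v < j \<and> warr s ''cnt'' v = 0}" for j s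
  have skip: "{v. v < Suc j \<and> cnt v = 0} = {v. v < j \<and> cnt v = 0}" if "cnt j > 0"
    for j and cnt :: "nat \<Rightarrow> nat"
    using that by (auto simp: less_Suc_eq)
  have ins: "{v. v < Suc j \<and> cnt v = 0} = insert j {v. v < j \<and> cnt v = 0}" if "cnt j = 0"
    for j and cnt :: "nat \<Rightarrow> nat"
    using that by (auto simp: less_Suc_eq)
  have img: "{..<Suc n} \<inter> {x. x \<noteq> n} = {..<n}" for n :: nat
    by auto
  have inj: "inj_on (q(n := j)) {..<Suc n}"
    if "inj_on q {..<n}" "q ` {..<n} = {v. v < j \<and> cnt v = 0}" for j n and q cnt :: "nat \<Rightarrow> nat"
  proof -
    have "inj_on (q(n := j)) {..<n}" using that(1) by (auto simp: inj_on_def)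
    then show ?thesis using that(2) by (auto simp: lessThan_Suc)
  qed
  have loop: "I 0 s' \<Longrightarrow> wp tc w (While (Less (Reg ''i'') (Reg ''r''))
       (If (Eq (WGet ''cnt'' (Reg ''i'')) (WConst 0))
         (WSet ''q'' (Reg ''n'') (Reg ''i'') ;; Inc ''n'')
         Skip ;;
        Inc ''i''))
      (\<lambda>t s'. I r s' \<and> t \<le> r * (1 + bcost (Less (Reg ''i'') (Reg ''r'')) + 30)
         + 1 + bcost (Less (Reg ''i'') (Reg ''r''))) s'" for s'
    by (rule wp_While_count) (use room' in \<open>simp_all add: I_def env_def skip ins img inj\<close>)
  show ?thesis
    unfolding enqueue_leaves_def wp_Seq wp_Assign
    by (rule wp_mono[OF loop]) (use assms room' in \<open>simp_all add: I_def env_def peeled_def\<close>)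
qed

lemma wp_peel:
  assumes "env s"
    "peeled 0 (reg s ''n'') (warr s ''cnt'') (warr s ''q'') (warr s ''hgt'') (warr s ''long'')"
  shows "wp tc w peel (\<lambda>t s'. t \<le> 80 * r + 20 \<and> env s' \<and> reg s' ''i'' = r \<and>
    long_paths (warr s' ''q'') (warr s' ''hgt'') (warr s' ''long'')) s"
proof -
  define I where "I s \<longleftrightarrow> env s \<and> peeled (reg s ''i'') (reg s ''n'') (warr s ''cnt'')
    (warr s ''q'') (warr s ''hgt'') (warr s ''long'')" for s
  have step: "wp tc w peel_body (\<lambda>t s'. I s' \<and>
      1 + bcost (Less (Reg ''i'') (Reg ''n'')) + t + 80 * (r - reg s' ''i'') \<le> 80 * (r - reg s ''i'')) s"
    if I: "I s" and b: "bval w (Less (Reg ''i'') (Reg ''n'')) s" for s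
  proof -
    have pe: "peeled (reg s ''i'') (reg s ''n'') (warr s ''cnt'')
      (warr s ''q'') (warr s ''hgt'') (warr s ''long'')" and i: "reg s ''i'' < reg s ''n''"
      using I b unfolding I_def by auto
    note F = peeled_parent[OF pe i] and n = peeled_le[OF pe]
    have par_eq: "warr s ''parent'' (warr s ''q'' (reg s ''i'')) = par (warr s ''q'' (reg s ''i''))"
      using I F(1) unfolding I_def env_def by auto
    have "warr s ''hgt'' (warr s ''q'' (reg s ''i'')) \<le> reg s ''i''"
      using pe F(1) unfolding peeled_def by auto
    then have H: "Suc (warr s ''hgt'' (warr s ''q'' (reg s ''i''))) < 2 ^ w" using room' i n by linarith
    have w: "Suc (reg s ''n'') < 2 ^ w" "Suc (reg s ''i'') < 2 ^ w" using room' i n by linarith+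
    have i': "r - reg s ''i'' = Suc (r - Suc (reg s ''i''))" using i n by simp
    have pe': "peeled (Suc (reg s ''i'')) n' cnt' q' H' L'"
      if "cnt' = (warr s ''cnt'')(par (warr s ''q'' (reg s ''i'')) :=
            warr s ''cnt'' (par (warr s ''q'' (reg s ''i''))) - 1)"
        "if warr s ''hgt'' (par (warr s ''q'' (reg s ''i''))) < Suc (warr s ''hgt'' (warr s ''q'' (reg s ''i'')))
         then H' = (warr s ''hgt'')(par (warr s ''q'' (reg s ''i'')) := Suc (warr s ''hgt'' (warr s ''q'' (reg s ''i''))))
           \<and> L' = (warr s ''long'')(par (warr s ''q'' (reg s ''i'')) := warr s ''q'' (reg s ''i''))
         else H' = warr s ''hgt'' \<and> L' = warr s ''long''"
        "if cnt' (par (warr s ''q'' (reg s ''i''))) = 0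
         then q' = (warr s ''q'')(reg s ''n'' := par (warr s ''q'' (reg s ''i''))) \<and> n' = Suc (reg s ''n'')
         else q' = warr s ''q'' \<and> n' = reg s ''n''"
      for cnt' H' L' q' n'
      by (rule peeled_step[OF pe i refl that])
    show ?thesis
      unfolding peel_body_def
      using I F(3) H w room'
      by (cases "warr s ''cnt'' (par (warr s ''q'' (reg s ''i''))) \<le> 1";
          cases "warr s ''hgt'' (par (warr s ''q'' (reg s ''i''))) < Suc (warr s ''hgt'' (warr s ''q'' (reg s ''i'')))")
        (simp_all add: I_def env_def par_eq i' pe')
  qed
  have fin: "env s \<and> reg s ''i'' = r \<and>
      long_paths (warr s ''q'') (warr s ''hgt'') ((warr s ''long'')(r := r))"
    if "I s" "\<not> reg s ''i'' < reg s ''n''" for s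
  proof -
    have "reg s ''n'' = reg s ''i''" using that unfolding I_def peeled_def by auto
    then show ?thesis using peeled_done that(1) unfolding I_def by metis
  qed
  \<comment> \<open>The queue grows during the loop, so the number of rounds is not fixed at the
    start; \<open>n \<le> r\<close> makes \<open>r - i\<close> a valid potential.\<close>
  have loop: "wp tc w (While (Less (Reg ''i'') (Reg ''n'')) peel_body)
      (\<lambda>t s''. env s'' \<and> reg s'' ''i'' = r \<and>
        long_paths (warr s'' ''q'') (warr s'' ''hgt'') ((warr s'' ''long'')(r := r)) \<and>
        t \<le> 80 * (r - reg s' ''i'') + 1 + bcost (Less (Reg ''i'') (Reg ''n''))) s'" if "I s'" for s'
    by (rule wp_mono[OF wp_While_potential[where I = I and \<Phi> = "\<lambda>s. 80 * (r - reg s ''i'')"]])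
      (use step fin that in auto)
  show ?thesis
    unfolding peel_def wp_Seq wp_Assign
    by (rule wp_mono[OF loop]) (use assms room' in \<open>simp_all add: I_def env_def\<close>)
qed

end

section \<open>Processing a single long path\<close>

locale path_run = trie_run +
  fixes G :: "string \<Rightarrow> nat \<Rightarrow> nat" and out0 :: "nat \<Rightarrow> int" and L :: "nat \<Rightarrow> nat" and u y h k i :: nat
  assumes G: "G ''long'' = L" "v \<le> r \<Longrightarrow> G ''parent'' v = par v" and out0: "out0 r = 0"
    and h: "0 < h" "h \<le> Suc r" and k: "k = min (length P) h"
    and u: "b < h \<Longrightarrow> (L ^^ b) u \<le> r" and y: "b < h \<Longrightarrow> (L ^^ b) y \<le> r"
    and done_y: "b < h \<Longrightarrow> out0 ((L ^^ b) y) = weighted par lab P ((L ^^ b) y)"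
    and diff: "a < h \<Longrightarrow> weighted par lab P ((L ^^ a) u) - weighted par lab P ((L ^^ a) y) =
      (\<Sum>q | q < length P \<and> q \<le> a. (lab ((L ^^ (a - q)) u) - lab ((L ^^ (a - q)) y)) * P ! (length P - 1 - q))"
begin

definition ctx :: "state \<Rightarrow> bool" where
  "ctx s \<longleftrightarrow> env s \<and> warr s = G \<and> reg s ''i'' = i \<and> reg s ''u'' = u \<and> reg s ''y'' = y \<and>
     reg s ''h'' = h \<and> reg s ''k'' = k"

text \<open>\<open>d\<close> is the number of label differences already stored behind the
  padding.\<close>

definition loaded :: "nat \<Rightarrow> state \<Rightarrow> bool" where
  "loaded d s \<longleftrightarrow> (\<forall>j < k. varr s ''Q'' j = P ! (length P - k + j)) \<and> (\<forall>j < k - 1. varr s ''S'' j = 0) \<and>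
     (\<forall>b < d. varr s ''S'' (k - 1 + b) = lab ((L ^^ b) u) - lab ((L ^^ b) y))"

lemma bounds: "0 < k" "k \<le> h" "k \<le> length P" "h + k < 2 ^ w" "length P < 2 ^ w"
proof -
  show k': "0 < k" "k \<le> h" "k \<le> length P" using k h pattern by auto
  show "h + k < 2 ^ w" using room' h k'(2) by linarith
  have "length P < 4 * (r + length P)" using pattern by (cases P) simp_all
  also note room
  finally show "length P < 2 ^ w" .
qed

lemma wp_load_pattern:
  assumes "ctx s" "varr s ''out'' = out0"
  shows "wp tc w load_pattern (\<lambda>t s'. t \<le> 40 * h + 10 \<and> ctx s' \<and> varr s' ''out'' = out0 \<and> loaded 0 s') s"
proof -
  define I where "I j s \<longleftrightarrow> ctx s \<and> varr s ''out'' = out0 \<and> reg s ''j'' = j \<and>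
    (\<forall>b < j. varr s ''Q'' b = P ! (length P - k + b) \<and> varr s ''S'' b = 0)" for j s
  have idx: "length P - k + j < 2 ^ w" "length P - k + j < length P" "Suc j < 2 ^ w" if "j < k" for j
    using that bounds by linarith+
  have "wp tc w (While (Less (Reg ''j'') (Reg ''k''))
       (VSet ''Q'' (Reg ''j'') (VGet ''P'' (WOp Add (WOp Sub (Reg ''m'') (Reg ''k'')) (Reg ''j''))) ;;
        VSet ''S'' (Reg ''j'') (VConst 0) ;;
        Inc ''j''))
      (\<lambda>t s'. I k s' \<and> t \<le> k * (1 + bcost (Less (Reg ''j'') (Reg ''k'')) + 20)
         + 1 + bcost (Less (Reg ''j'') (Reg ''k''))) s'" if "I 0 s'" for s'
    using that by (rule wp_While_count) (use room' idx G out0 in \<open>simp_all add: I_def ctx_def env_def less_Suc_eq\<close>)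
  then show ?thesis
    unfolding load_pattern_def wp_Seq wp_Assign
    by (rule wp_mono) (use assms bounds room' G out0 in \<open>simp_all add: I_def ctx_def env_def loaded_def\<close>)
qed

lemma wp_load_differences:
  assumes "ctx s" "varr s ''out'' = out0" "loaded 0 s"
  shows "wp tc w load_differences (\<lambda>t s'. t \<le> 40 * h + 20 \<and> ctx s' \<and> varr s' ''out'' = out0 \<and> loaded h s') s"
proof -
  define I where "I j s \<longleftrightarrow> ctx s \<and> varr s ''out'' = out0 \<and> reg s ''j'' = j \<and>
    reg s ''x'' = (L ^^ j) u \<and> reg s ''z'' = (L ^^ j) y \<and> loaded j s" for j s
  \<comment> \<open>Writing a difference never touches the padding.\<close>
  have shift: "\<not> k + j - Suc 0 < k - Suc 0" for j
    by arith
  have idx: "k - Suc 0 + j < 2 ^ w" "Suc j < 2 ^ w" if "j < h" for j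
    using that bounds by linarith+
  have "wp tc w (While (Less (Reg ''j'') (Reg ''h''))
       (VSet ''S'' (WOp Add (WOp Sub (Reg ''k'') (WConst 1)) (Reg ''j''))
          (VOp VSub (VGet ''label'' (Reg ''x'')) (VGet ''label'' (Reg ''z''))) ;;
        Assign ''x'' (WGet ''long'' (Reg ''x'')) ;;
        Assign ''z'' (WGet ''long'' (Reg ''z'')) ;;
        Inc ''j''))
      (\<lambda>t s'. I h s' \<and> t \<le> h * (1 + bcost (Less (Reg ''j'') (Reg ''h'')) + 30)
         + 1 + bcost (Less (Reg ''j'') (Reg ''h''))) s'" if "I 0 s'" for s'
    using that by (rule wp_While_count)
      (use room' idx u y G out0 shift in \<open>simp_all add: I_def ctx_def env_def loaded_def less_Suc_eq\<close>)
  then show ?thesis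
    unfolding load_differences_def wp_Seq wp_Assign
    by (rule wp_mono) (use assms G out0 in \<open>simp_all add: I_def ctx_def env_def loaded_def\<close>)
qed

text \<open>Every write stores the final value of its cell. Hence outputs that are already correct
  stay correct, whichever cells are hit; this is why the postcondition offers the final or the old
  value.\<close>

lemma wp_store_path:
  assumes "ctx s" "varr s ''out'' = out0"
    "\<forall>a < h. varr s ''D'' a = weighted par lab P ((L ^^ a) u) - weighted par lab P ((L ^^ a) y)"
  shows "wp tc w store_path (\<lambda>t s'. t \<le> 40 * h + 20 \<and> ctx s' \<and>
    (\<forall>v. varr s' ''out'' v = weighted par lab P v \<or> varr s' ''out'' v = out0 v) \<and>
    (\<forall>a < h. varr s' ''out'' ((L ^^ a) u) = weighted par lab P ((L ^^ a) u))) s"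
proof -
  define I where "I j s \<longleftrightarrow> ctx s \<and> reg s ''j'' = j \<and>
    reg s ''x'' = (L ^^ j) u \<and> reg s ''z'' = (L ^^ j) y \<and>
    (\<forall>a < h. varr s ''D'' a = weighted par lab P ((L ^^ a) u) - weighted par lab P ((L ^^ a) y)) \<and>
    (\<forall>a < h. varr s ''out'' ((L ^^ a) y) = weighted par lab P ((L ^^ a) y)) \<and>
    (\<forall>v. varr s ''out'' v = weighted par lab P v \<or> varr s ''out'' v = out0 v) \<and>
    (\<forall>a < j. varr s ''out'' ((L ^^ a) u) = weighted par lab P ((L ^^ a) u))" for j s
  have idx: "Suc j < 2 ^ w" if "j < h" for j
    using that bounds by linarith+
  \<comment> \<open>A write to the sentinel would store \<open>0\<close>, as \<open>env\<close>
    demands.\<close>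
  have W: "weighted par lab P v = 0" if "r = v" for v
    using weighted_sentinel that by simp
  have "wp tc w (While (Less (Reg ''j'') (Reg ''h''))
       (VSet ''out'' (Reg ''x'') (VOp VAdd (VGet ''out'' (Reg ''z'')) (VGet ''D'' (Reg ''j''))) ;;
        Assign ''x'' (WGet ''long'' (Reg ''x'')) ;;
        Assign ''z'' (WGet ''long'' (Reg ''z'')) ;;
        Inc ''j''))
      (\<lambda>t s'. I h s' \<and> t \<le> h * (1 + bcost (Less (Reg ''j'') (Reg ''h'')) + 30)
         + 1 + bcost (Less (Reg ''j'') (Reg ''h''))) s'" if "I 0 s'" for s'
    using that by (rule wp_While_count)
      (use room' idx u y G in \<open>simp_all add: W I_def ctx_def env_def less_Suc_eq\<close>)
  then show ?thesis
    unfolding store_path_def wp_Seq wp_Assign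
    by (rule wp_mono) (use assms done_y G in \<open>simp_all add: I_def ctx_def env_def\<close>)
qed

lemma wp_convolve_path:
  assumes "ctx s" "varr s ''out'' = out0" "loaded h s"
  shows "wp tc w (Convolve ''D'' ''S'' (WOp Sub (WOp Add (Reg ''h'') (Reg ''k'')) (WConst 1)) ''Q'' (Reg ''k''))
    (\<lambda>t s'. t \<le> 10 + tc (h + k - 1) k \<and> ctx s' \<and> varr s' ''out'' = out0 \<and>
    (\<forall>a < h. varr s' ''D'' a = weighted par lab P ((L ^^ a) u) - weighted par lab P ((L ^^ a) y))) s"
proof -
  have "conv (varr s ''S'') (varr s ''Q'') k a =
      weighted par lab P ((L ^^ a) u) - weighted par lab P ((L ^^ a) y)" if "a < h" for a
    unfolding diff[OF that]
  proof (rule conv_padded[OF bounds(1,3)])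
    show "k = length P \<or> a < k" using k that by auto
  qed (use assms(3) that in \<open>simp_all add: loaded_def\<close>)
  moreover have "h + k - 1 - k = h - 1" using bounds by simp
  moreover have "k \<le> h + k - 1" "a < h \<Longrightarrow> a \<le> h - 1" for a using h by simp_all
  ultimately show ?thesis
    using assms room' bounds G by (intro wp_Convolve) (simp_all add: ctx_def env_def)
qed

lemma wp_process_path:
  assumes "env s" "warr s = G" "reg s ''i'' = i" "reg s ''u'' = u" "reg s ''y'' = y"
    "Suc (G ''hgt'' u) = h" "varr s ''out'' = out0"
  shows "wp tc w process_path (\<lambda>t s'. t \<le> 120 * h + 100 + tc (h + k - 1) k \<and>
    env s' \<and> warr s' = G \<and> reg s' ''i'' = i \<and>
    (\<forall>v. varr s' ''out'' v = weighted par lab P v \<or> varr s' ''out'' v = out0 v) \<and>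
    (\<forall>a < h. varr s' ''out'' ((L ^^ a) u) = weighted par lab P ((L ^^ a) u))) s"
proof -
  have "h < 2 ^ w" using bounds by linarith
  then have init: "wp tc w (Assign ''h'' (WOp Add (WGet ''hgt'' (Reg ''u'')) (WConst 1)))
      (\<lambda>t. wp tc w (If (Less (Reg ''m'') (Reg ''h'')) (Assign ''k'' (Reg ''m'')) (Assign ''k'' (Reg ''h'')))
        (\<lambda>t' s'. t + t' \<le> 20 \<and> ctx s' \<and> varr s' ''out'' = out0)) s"
    using assms room' unfolding ctx_def env_def by (cases "length P < h") (simp_all add: k)
  show ?thesis
    unfolding process_path_def wp_Seq
    apply (rule wp_mono[OF init], erule wp_mono, elim conjE)
    apply (rule wp_mono[OF wp_load_pattern], assumption+, elim conjE)
    apply (rule wp_mono[OF wp_load_differences], assumption+, elim conjE)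
    apply (rule wp_mono[OF wp_convolve_path], assumption+, elim conjE)
    apply (rule wp_mono[OF wp_store_path], assumption+, elim conjE)
    apply (simp add: ctx_def)
    done
qed

end

section \<open>All long paths and the total running time\<close>

context trie_run
begin

definition path_cost :: "nat \<Rightarrow> nat" where
  "path_cost h = 120 * h + 100 + tc (h + min (length P) h - 1) (min (length P) h)"

text \<open>The queue is read backwards, so the parent of \<open>u\<close> has been handled before
  \<open>u\<close> and the outputs along the comparison path are available. The potential sums the
  charges of the queue entries still to come.\<close>

lemma wp_process_paths:
  assumes s: "env s" "reg s ''i'' = r"
    and lp: "long_paths (warr s ''q'') (warr s ''hgt'') (warr s ''long'')"
  shows "wp tc w process_paths (\<lambda>t s'. (\<forall>v < r. varr s' ''out'' v = weighted par lab P v) \<and>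
    t \<le> 10 + 40 * r + (\<Sum>v | v < r \<and> path_top (warr s ''long'') v. path_cost (Suc (warr s ''hgt'' v)))) s"
proof -
  define G where "G = warr s"
  define q H L where "q = G ''q''" and "H = G ''hgt''" and "L = G ''long''"
  have lp: "long_paths q H L" using lp unfolding q_def H_def L_def G_def .
  then have q: "bij_betw q {..<r} {..<r}" and Lr: "L r = r"
    and H_less: "\<And>v. v < r \<Longrightarrow> H v < H (par v)" and H_le: "\<And>v. v \<le> r \<Longrightarrow> H v \<le> r"
    and topo: "\<And>j. j < r \<Longrightarrow> par (q j) = r \<or> (\<exists>l < r. j < l \<and> q l = par (q j))"
    unfolding long_paths_def by auto
  have Lr': "(L ^^ a) r = r" for a by (induction a) (simp_all add: Lr)
  \<comment> \<open>The charge of a node: constant work for its round, plus the whole path if it is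
    a top.\<close>
  define f where "f v = 40 + (if path_top L v then path_cost (Suc (H v)) else 0)" for v
  \<comment> \<open>Each handled node vouches for the entire long path below it, not only for
    itself; later rounds read exactly these values.\<close>
  define finished where "finished i out \<longleftrightarrow> (\<forall>j. i \<le> j \<longrightarrow> j < r \<longrightarrow> (\<forall>a \<le> H (q j).
    out ((L ^^ a) (q j)) = weighted par lab P ((L ^^ a) (q j))))" for i and out :: "nat \<Rightarrow> int"
  define I where "I s \<longleftrightarrow> env s \<and> warr s = G \<and> reg s ''i'' \<le> r \<and> finished (reg s ''i'') (varr s ''out'')" for s
  define b where "b = Less (WConst 0) (Reg ''i'')"
  define body where "body =
       (Assign ''i'' (WOp Sub (Reg ''i'') (WConst 1)) ;;
        Assign ''u'' (WGet ''q'' (Reg ''i'')) ;;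
        Assign ''y'' (WGet ''long'' (WGet ''parent'' (Reg ''u''))) ;;
        If (Eq (Reg ''y'') (Reg ''u'')) Skip process_path)"
  have step: "wp tc w body
      (\<lambda>t s'. I s' \<and> 1 + bcost b + t + (\<Sum>j < reg s' ''i''. f (q j)) \<le> (\<Sum>j < reg s ''i''. f (q j))) s"
    if I: "I s" and b: "bval w b s" for s
  proof -
    from b have "0 < reg s ''i''" unfolding b_def by simp
    then obtain i where i: "reg s ''i'' = Suc i" by (cases "reg s ''i''") auto
    define u x where "u = q i" and "x = par u"
    have ir: "i < r" using I i unfolding I_def by simp
    then have u: "u < r" unfolding u_def using q by (auto simp: bij_betw_def)
    have x: "x \<le> r" unfolding x_def using u par_le by simp
    have G: "G ''parent'' v = par v" if "v \<le> r" for v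
      using I that unfolding I_def env_def by auto
    then have Gx: "G ''parent'' u = x" using u unfolding x_def by simp
    have fx: "varr s ''out'' ((L ^^ a) (L x)) = weighted par lab P ((L ^^ a) (L x)) \<and> (L ^^ a) (L x) \<le> r"
      if a: "a \<le> H u" for a
    proof (cases "x = r")
      case True
      then show ?thesis using I unfolding I_def env_def by (simp add: Lr Lr' weighted_sentinel)
    next
      case False
      then obtain l where l: "l < r" "i < l" "q l = x" using topo[OF ir] unfolding x_def u_def by auto
      have "Suc a \<le> H x" using H_less[OF u] a unfolding x_def by simp
      then have "varr s ''out'' ((L ^^ Suc a) x) = weighted par lab P ((L ^^ Suc a) x)"
        using I l unfolding I_def finished_def i by (metis Suc_leI)
      moreover have "(L ^^ Suc a) x \<le> r"
        using long_descend[OF lp, of x "Suc a"] \<open>Suc a \<le> H x\<close> False x by simp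
      ultimately show ?thesis by (simp add: funpow_swap1)
    qed
    show ?thesis
    proof (cases "L x = u")
      case True
      \<comment> \<open>The path below the long child \<open>u\<close> is part of the one below its
        parent \<open>x\<close>, which is finished.\<close>
      have "finished i (varr s ''out'')"
        using I True fx unfolding I_def finished_def i u_def[symmetric] by (metis Suc_leI le_neq_implies_less u_def)
      then show ?thesis
        using I i ir room' True G Gx unfolding body_def I_def env_def b_def f_def
        by (simp add: q_def[symmetric] L_def[symmetric] u_def[symmetric])
    next
      case False
      interpret path: path_run r par dep lab P w tc G "varr s ''out''" L u "L x" "Suc (H u)"
        "min (length P) (Suc (H u))" i
      proof
        show "weighted par lab P ((L ^^ a) u) - weighted par lab P ((L ^^ a) (L x)) =
           (\<Sum>q | q < length P \<and> q \<le> a. (lab ((L ^^ (a - q)) u) - lab ((L ^^ (a - q)) (L x))) *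
              P ! (length P - 1 - q))" if "a < Suc (H u)" for a
          using weighted_long_path[OF lp u, of a lab P] that lab_sentinel
          unfolding x_def[symmetric] by (simp add: funpow_swap1)
        show "(L ^^ a) u \<le> r" if "a < Suc (H u)" for a
          using long_descend[OF lp u, of a] that by simp
      qed (use fx I G H_le[of u] u L_def in \<open>auto simp: I_def env_def\<close>)
      define s1 where "s1 = s\<lparr>reg := (reg s)(''i'' := i, ''u'' := u, ''y'' := L x)\<rparr>"
      have "wp tc w process_path (\<lambda>t s'. t \<le> path_cost (Suc (H u)) \<and>
          env s' \<and> warr s' = G \<and> reg s' ''i'' = i \<and>
          (\<forall>v. varr s' ''out'' v = weighted par lab P v \<or> varr s' ''out'' v = varr s ''out'' v) \<and>
          (\<forall>a < Suc (H u). varr s' ''out'' ((L ^^ a) u) = weighted par lab P ((L ^^ a) u))) s1"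
        unfolding path_cost_def
        by (rule path.wp_process_path) (use I G in \<open>simp_all add: I_def env_def s1_def H_def\<close>)
      then have "wp tc w process_path
          (\<lambda>t s'. I s' \<and> 30 + t + (\<Sum>j < reg s' ''i''. f (q j)) \<le> (\<Sum>j < reg s ''i''. f (q j))) s1"
      proof (rule wp_mono, elim conjE)
        fix t s'
        assume *: "t \<le> path_cost (Suc (H u))" "env s'" "warr s' = G" "reg s' ''i'' = i"
          "\<forall>v. varr s' ''out'' v = weighted par lab P v \<or> varr s' ''out'' v = varr s ''out'' v"
          "\<forall>a < Suc (H u). varr s' ''out'' ((L ^^ a) u) = weighted par lab P ((L ^^ a) u)"
        have "finished i (varr s' ''out'')" unfolding finished_def
        proof (intro allI impI)
          fix j a assume j: "i \<le> j" "j < r" "a \<le> H (q j)"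
          show "varr s' ''out'' ((L ^^ a) (q j)) = weighted par lab P ((L ^^ a) (q j))"
          proof (cases "j = i")
            case True
            then show ?thesis using *(6) j(3) unfolding u_def by simp
          next
            case False
            then have "varr s ''out'' ((L ^^ a) (q j)) = weighted par lab P ((L ^^ a) (q j))"
              using I j unfolding I_def finished_def i by simp
            then show ?thesis using *(5) by metis
          qed
        qed
        moreover have "path_top L u" using False unfolding path_top_def x_def .
        ultimately show "I s' \<and> 30 + t + (\<Sum>j < reg s' ''i''. f (q j)) \<le> (\<Sum>j < reg s ''i''. f (q j))"
          using * ir unfolding I_def i by (simp add: f_def u_def)
      qed
      note path = this
      have s1: "s\<lparr>reg := (reg s)(''i'' := i, ''u'' := u, ''y'' := L x)\<rparr> = s1"
        "reg s1 ''u'' = u" "reg s1 ''y'' = L x"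
        unfolding s1_def by simp_all
      have "warr s = G" using I unfolding I_def by simp
      then show ?thesis
        unfolding body_def
        apply (simp add: i Gx False s1 room' q_def[symmetric] L_def[symmetric] u_def[symmetric])
        apply (rule wp_mono[OF path])
        apply (simp add: b_def i u_def)
        done
    qed
  qed
  have sum: "(\<Sum>j<r. f (q j)) = 40 * r +
      (\<Sum>v | v < r \<and> path_top (warr s ''long'') v. path_cost (Suc (warr s ''hgt'' v)))"
  proof -
    have "(\<Sum>j<r. f (q j)) = (\<Sum>v<r. f v)" by (rule sum.reindex_bij_betw[OF q])
    also have "\<dots> = 40 * r + (\<Sum>v<r. if path_top L v then path_cost (Suc (H v)) else 0)"
      unfolding f_def by (simp add: sum.distrib)
    also have "(\<Sum>v<r. if path_top L v then path_cost (Suc (H v)) else 0) =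
        (\<Sum>v | v < r \<and> path_top L v. path_cost (Suc (H v)))"
      by (subst sum.inter_filter[symmetric]) (auto intro!: sum.cong)
    finally show ?thesis unfolding L_def H_def G_def .
  qed
  have "wp tc w process_paths (\<lambda>t s'. I s' \<and> \<not> bval w b s' \<and>
      t \<le> (\<Sum>j < reg s ''i''. f (q j)) + 1 + bcost b) s"
    unfolding process_paths_def b_def[symmetric] body_def[symmetric]
    by (rule wp_While_potential[where \<Phi> = "\<lambda>s. \<Sum>j < reg s ''i''. f (q j)"])
      (use s step in \<open>auto simp: I_def G_def finished_def\<close>)
  then show ?thesis
  proof (rule wp_mono, elim conjE)
    fix t s' assume *: "I s'" "\<not> bval w b s'" "t \<le> (\<Sum>j < reg s ''i''. f (q j)) + 1 + bcost b"
    have "varr s' ''out'' v = weighted par lab P v" if "v < r" for v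
    proof -
      have "v \<in> q ` {..<r}" using that q by (auto simp: bij_betw_def)
      then obtain j where j: "j < r" "q j = v" by auto
      moreover have "finished 0 (varr s' ''out'')" using * unfolding I_def b_def by simp
      ultimately have "\<forall>a \<le> H v. varr s' ''out'' ((L ^^ a) v) = weighted par lab P ((L ^^ a) v)"
        unfolding finished_def by auto
      from this[rule_format, of 0] show ?thesis by simp
    qed
    then show "(\<forall>v < r. varr s' ''out'' v = weighted par lab P v) \<and> t \<le> 10 + 40 * r +
        (\<Sum>v | v < r \<and> path_top (warr s ''long'') v. path_cost (Suc (warr s ''hgt'' v)))"
      using *(3) s(2) sum by (simp add: b_def)
  qed
qed

text \<open>The decomposition is existential because ties between children are resolved by the run
  itself.\<close>

lemma wp_after_sentinel:
  assumes "env s"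
  shows "wp tc w (clear_counters ;; count_children ;; enqueue_leaves ;; peel ;; process_paths)
    (\<lambda>t s'. (\<forall>v < r. varr s' ''out'' v = weighted par lab P v) \<and>
      (\<exists>q H L. long_paths q H L \<and>
        t \<le> 100 + 300 * r + (\<Sum>v | v < r \<and> path_top L v. path_cost (Suc (H v))))) s"
  unfolding wp_Seq
  apply (rule wp_mono[OF wp_clear_counters[OF assms]], elim conjE)
  apply (rule wp_mono[OF wp_count_children], assumption+, elim conjE)
  apply (rule wp_mono[OF wp_enqueue_leaves], assumption+, elim conjE)
  apply (rule wp_mono[OF wp_peel], assumption+, elim conjE)
  apply (rule wp_mono[OF wp_process_paths], assumption+, elim conjE)
  apply (intro conjI exI, assumption, assumption)
  apply simp
  done

text \<open>A path of \<open>h\<close> nodes convolves vectors of lengths below \<open>2 * h\<close>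
  and at most \<open>length P\<close>; summing over disjoint paths turns \<open>h\<close> into
  \<open>r\<close>. The factor \<open>220\<close> absorbs \<open>120 * h + 100\<close>.\<close>

lemma path_cost_sum:
  assumes lp: "long_paths q H L" and tc: "\<And>n k. 0 < k \<Longrightarrow> k \<le> n \<Longrightarrow> real (tc n k) \<le> \<kappa> * (real n * lg k)"
    and \<kappa>: "0 \<le> \<kappa>"
  shows "real (\<Sum>v | v < r \<and> path_top L v. path_cost (Suc (H v))) \<le>
    (220 + 2 * \<kappa>) * (real r * lg (length P))"
proof -
  have lg1: "1 \<le> lg n" for n unfolding lg_def by simp
  have cost: "real (path_cost h) \<le> (220 + 2 * \<kappa>) * (real h * lg (length P))" if h: "0 < h" for h
  proof -
    define k where "k = min (length P) h"
    have k: "0 < k" "k \<le> h" "k \<le> length P" using h pattern unfolding k_def by auto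
    have "lg k \<le> lg (length P)"
      using k unfolding lg_def by (intro max.mono log_mono) auto
    then have "real (h + k - 1) * lg k \<le> (2 * real h) * lg (length P)"
      using k lg1[of k] by (intro mult_mono) auto
    then have "\<kappa> * (real (h + k - 1) * lg k) \<le> \<kappa> * ((2 * real h) * lg (length P))"
      using \<kappa> by (rule mult_left_mono)
    moreover have "real (tc (h + k - 1) k) \<le> \<kappa> * (real (h + k - 1) * lg k)"
      using tc[of k "h + k - 1"] k by simp
    moreover have "real h * 1 \<le> real h * lg (length P)"
      using lg1 by (rule mult_left_mono) simp
    moreover have "1 \<le> real h" using h by simp
    moreover have "real (path_cost h) = 120 * real h + 100 + real (tc (h + k - 1) k)"
      unfolding path_cost_def k_def[symmetric] by simp
    moreover have "(220 + 2 * \<kappa>) * (real h * lg (length P)) =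
        220 * (real h * lg (length P)) + \<kappa> * ((2 * real h) * lg (length P))"
      by (simp add: algebra_simps)
    ultimately show ?thesis by linarith
  qed
  have "real (\<Sum>v | v < r \<and> path_top L v. path_cost (Suc (H v))) \<le>
      (\<Sum>v | v < r \<and> path_top L v. (220 + 2 * \<kappa>) * (real (Suc (H v)) * lg (length P)))"
    unfolding of_nat_sum by (rule sum_mono) (rule cost, simp)
  also have "\<dots> = (220 + 2 * \<kappa>) * (real (\<Sum>v | v < r \<and> path_top L v. Suc (H v)) * lg (length P))"
    unfolding of_nat_sum by (simp only: sum_distrib_left sum_distrib_right)
  also have "\<dots> \<le> (220 + 2 * \<kappa>) * (real r * lg (length P))"
    using sum_path_lengths[OF lp] \<kappa> lg1[of "length P"]
    by (intro mult_left_mono mult_right_mono) (simp_all del: of_nat_sum)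
  finally show ?thesis .
qed

end

lemma wp_add_sentinel:
  assumes T: "is_trie T" and P: "P \<noteq> []" and room: "4 * (trie_size T + length P) \<le> 2 ^ w"
    and s: "input w T P s"
  shows "wp tc w add_sentinel (\<lambda>t s'. t \<le> 20 \<and>
    trie_run.env (trie_size T) (sparent T) (slabel T) P s') s"
proof -
  interpret trie_run "trie_size T" "sparent T" "depth T" "slabel T" P w tc
    using sentinel_tree_sparent[OF T] P room
    by (simp add: trie_run_def trie_run_axioms_def slabel_def)
  show ?thesis
    unfolding add_sentinel_def env_def
    using s T by (auto simp: input_def is_trie_def sparent_def slabel_def)
qed

text \<open>The program and the word-size factor are fixed before \<open>tc\<close>; only
  \<open>c\<close> may depend on the constant hidden in the convolution time.\<close>

theorem theorem4:
  "\<exists>(prog :: com) (K :: nat). \<forall>tc. fft_time tc \<longrightarrow>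
     (\<exists>c :: real. \<forall>(T :: trie) (P :: int list) (w :: nat) (s :: state).
        is_trie T \<longrightarrow> P \<noteq> [] \<longrightarrow> K * (trie_size T + length P) \<le> 2 ^ w \<longrightarrow> input w T P s \<longrightarrow>
        (\<exists>t s'. exec tc w prog s t s' \<and>
           (\<forall>v < trie_size T. depth T v \<ge> length P \<longrightarrow> varr s' ''out'' v = trie_conv T P v) \<and>
           real t \<le> c * (real (trie_size T) * lg (length P))))"
proof (intro exI[of _ trie_conv_prog] exI[of _ "4 :: nat"] allI impI)
  fix tc assume "fft_time tc"
  then obtain \<kappa>0 where \<kappa>0: "\<And>n k. 0 < k \<Longrightarrow> k \<le> n \<Longrightarrow> real (tc n k) \<le> \<kappa>0 * (real n * lg k)"
    unfolding fft_time_def by blast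
  \<comment> \<open>The given constant might be negative; monotonicity of products needs a
    nonnegative one.\<close>
  define \<kappa> where "\<kappa> = max \<kappa>0 0"
  have lg1: "1 \<le> lg n" for n unfolding lg_def by simp
  have \<kappa>: "real (tc n k) \<le> \<kappa> * (real n * lg k)" if "0 < k" "k \<le> n" for n k
  proof -
    have "\<kappa>0 * (real n * lg k) \<le> \<kappa> * (real n * lg k)"
      unfolding \<kappa>_def using lg1[of k] by (intro mult_right_mono) auto
    then show ?thesis using \<kappa>0[OF that] by linarith
  qed
  show "\<exists>c :: real. \<forall>T P w s.
        is_trie T \<longrightarrow> P \<noteq> [] \<longrightarrow> 4 * (trie_size T + length P) \<le> 2 ^ w \<longrightarrow> input w T P s \<longrightarrow>
        (\<exists>t s'. exec tc w trie_conv_prog s t s' \<and>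
           (\<forall>v < trie_size T. depth T v \<ge> length P \<longrightarrow> varr s' ''out'' v = trie_conv T P v) \<and>
           real t \<le> c * (real (trie_size T) * lg (length P)))"
  \<comment> \<open>\<open>640 = 120 + 300 + 220\<close>: fixed costs, linear passes, and path
    costs, each measured in multiples of \<open>X\<close>.\<close>
  proof (intro exI[of _ "640 + 2 * \<kappa>"] allI impI)
    fix T P w s
    assume T: "is_trie T" and P: "P \<noteq> []" and room: "4 * (trie_size T + length P) \<le> 2 ^ w"
      and s: "input w T P s"
    interpret trie_run "trie_size T" "sparent T" "depth T" "slabel T" P w tc
      using sentinel_tree_sparent[OF T] P room
      by (simp add: trie_run_def trie_run_axioms_def slabel_def)
    define X where "X = real (trie_size T) * lg (length P)"
    have r: "1 \<le> real (trie_size T)" using T unfolding is_trie_def by (simp add: Suc_le_eq)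
    have "real (trie_size T) * 1 \<le> X" unfolding X_def using lg1 by (rule mult_left_mono) simp
    with r have X: "1 \<le> X" "real (trie_size T) \<le> X" by simp_all
    have "wp tc w trie_conv_prog (\<lambda>t s'. (\<forall>v < trie_size T. varr s' ''out'' v = weighted (sparent T) (slabel T) P v) \<and>
      (\<exists>q H L. long_paths q H L \<and>
        t \<le> 120 + 300 * trie_size T + (\<Sum>v | v < trie_size T \<and> path_top L v. path_cost (Suc (H v))))) s"
      unfolding trie_conv_prog_def wp_Seq[of _ _ add_sentinel]
      apply (rule wp_mono[OF wp_add_sentinel[OF T P room s]], elim conjE)
      apply (rule wp_mono[OF wp_after_sentinel], assumption, elim conjE exE)
      apply (intro conjI exI, assumption, assumption)
      apply simp
      done
    then have "wp tc w trie_conv_prog (\<lambda>t s'.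
      (\<forall>v < trie_size T. length P \<le> depth T v \<longrightarrow> varr s' ''out'' v = trie_conv T P v) \<and>
      real t \<le> (640 + 2 * \<kappa>) * X) s"
    proof (rule wp_mono)
      fix t s'
      assume *: "(\<forall>v < trie_size T. varr s' ''out'' v = weighted (sparent T) (slabel T) P v) \<and>
        (\<exists>q H L. long_paths q H L \<and>
          t \<le> 120 + 300 * trie_size T + (\<Sum>v | v < trie_size T \<and> path_top L v. path_cost (Suc (H v))))"
      then obtain q H L where lp: "long_paths q H L" and
        t: "t \<le> 120 + 300 * trie_size T + (\<Sum>v | v < trie_size T \<and> path_top L v. path_cost (Suc (H v)))"
        by blast
      have "0 \<le> \<kappa>" unfolding \<kappa>_def by simp
      then have "real (\<Sum>v | v < trie_size T \<and> path_top L v. path_cost (Suc (H v))) \<le> (220 + 2 * \<kappa>) * X"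
        unfolding X_def by (intro path_cost_sum[OF lp \<kappa>])
      moreover have "real t \<le> 120 + 300 * real (trie_size T) +
          real (\<Sum>v | v < trie_size T \<and> path_top L v. path_cost (Suc (H v)))"
        using t by linarith
      ultimately have "real t \<le> (640 + 2 * \<kappa>) * X"
        using X unfolding distrib_right by linarith
      then show "(\<forall>v < trie_size T. length P \<le> depth T v \<longrightarrow> varr s' ''out'' v = trie_conv T P v) \<and>
          real t \<le> (640 + 2 * \<kappa>) * X"
        using * trie_conv_weighted[OF T] by simp
    qed
    then show "\<exists>t s'. exec tc w trie_conv_prog s t s' \<and>
           (\<forall>v < trie_size T. depth T v \<ge> length P \<longrightarrow> varr s' ''out'' v = trie_conv T P v) \<and>
           real t \<le> (640 + 2 * \<kappa>) * (real (trie_size T) * lg (length P))"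
      unfolding wp_def X_def .
  qed
qed

end
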